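(* Let $d\ge1$, $\gamma>0$ and $f\in E^d_{\mathcal F}(\tanh2\gamma)$. Then there is $C>0$ (depending on $f,\gamma,d$) such that for all $\alpha\in\mathbb N_0^d$, $$|\langle f,\mathbf h_\alpha\rangle|\le C\, d^{|\alpha|}\,|\alpha|^{\frac{d-2}{4}}\,e^{-\gamma|\alpha|}.$$
   Context: Fourier transform $\hat f(\xi)=(2\pi)^{-d/2}\int e^{-i\xi\cdot x}f(x)dx$. For $a>0$ the Hardy class $E^d_{\mathcal F}(a)$ is the set of $f\in(L^1\cap L^2)(\mathbb R^d)$ such that for some $C>0$, $|f(x)|\le Ce^{-a|x|^2/2}$ and $|\hat f(\xi)|\le Ce^{-a|\xi|^2/2}$ for all $x,\xi$. Hermite functions $h_k(x)=(-1)^k(2^kk!\sqrt\pi)^{-1/2}e^{x^2/2}\frac{d^k}{dx^k}e^{-x^2}$, $\mathbf h_\alpha(x)=\prod_jh_{\alpha_j}(x_j)$; $|\alpha|=\alpha_1+\dots+\alpha_d$; $\langle f,g\rangle=\int f\bar g$.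
   Formalization: The estimate is proved for all α with |α| ≥ 1; at α = 0 the factor |α|^{(d-2)/4} is undefined for d = 1 and zero for d ≥ 3, where the bound fails (e.g. for f = e^{-|x|²/2}). *)

theory Defs
  imports "HOL-Analysis.Analysis"
begin

definition fourier :: "(real^'n \<Rightarrow> complex) \<Rightarrow> real^'n \<Rightarrow> complex" where
  "fourier f \<xi> = complex_of_real ((2 * pi) powr (- real CARD('n) / 2)) *
     (LINT x|lborel. exp (- \<i> * complex_of_real (\<xi> \<bullet> x)) * f x)"

definition hardy_class :: "real \<Rightarrow> (real^'n \<Rightarrow> complex) set" where
  "hardy_class a = {f. integrable lborel f \<and>
      integrable lborel (\<lambda>x. (norm (f x))\<^sup>2) \<and>
      (\<exists>C>0. (\<forall>x. norm (f x) \<le> C * exp (- a * (norm x)\<^sup>2 / 2)) \<and>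
             (\<forall>\<xi>. norm (fourier f \<xi>) \<le> C * exp (- a * (norm \<xi>)\<^sup>2 / 2)))}"

definition hermite_fun :: "nat \<Rightarrow> real \<Rightarrow> real" where
  "hermite_fun k x = (-1) ^ k * (2 ^ k * fact k * sqrt pi) powr (-1/2) * exp (x\<^sup>2 / 2) *
      (deriv ^^ k) (\<lambda>t. exp (- t\<^sup>2)) x"

definition hermite_multi :: "('n \<Rightarrow> nat) \<Rightarrow> real^'n \<Rightarrow> real" where
  "hermite_multi \<alpha> x = (\<Prod>j\<in>UNIV. hermite_fun (\<alpha> j) (x $ j))"

definition multi_abs :: "('n::finite \<Rightarrow> nat) \<Rightarrow> nat" where
  "multi_abs \<alpha> = (\<Sum>j\<in>UNIV. \<alpha> j)"

definition l2_inner :: "(real^'n \<Rightarrow> complex) \<Rightarrow> (real^'n \<Rightarrow> complex) \<Rightarrow> complex" where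
  "l2_inner f g = (LINT x|lborel. f x * cnj (g x))"

end

theory Submission
  imports Defs "HOL-Probability.Probability" "HOL-Complex_Analysis.Complex_Analysis"
    "HOL-Real_Asymp.Real_Asymp"
begin

text \<open>
  For a real unit vector \<open>w\<close>, restrict the Bargmann transform of \<open>f\<close> to the complex line spanned by
  \<open>w\<close>. With \<open>s = exp (- 2 \<gamma>)\<close> the resulting entire function \<open>g\<close> satisfies
  \<open>|g(u + iv)| \<le> K exp (s\<^sup>2u\<^sup>2 + v\<^sup>2)\<close> by the decay of \<open>f\<close> and \<open>|g(u + iv)| \<le> K exp (u\<^sup>2 + s\<^sup>2v\<^sup>2)\<close>
  by the decay of its Fourier transform. The two bounds agree with \<open>exp (s Im (t\<^sup>2))\<close> on the rays of
  slope \<open>s\<close> and \<open>1/s\<close>, whose angle is less than a quarter turn, so Phragmen--Lindelof gives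
  \<open>|g(t)| \<le> K exp (s Im (t\<^sup>2))\<close> between them. On a circle of radius \<open>r\<close> the maximum \<open>exp (s r\<^sup>2)\<close>
  is thus attained only near the four diagonals, with Gaussian fall-off, and Cauchy's formula gains a
  factor \<open>1/r\<close>; with \<open>r\<^sup>2 = n/(2s)\<close> this bounds the \<open>n\<close>-th Taylor coefficient of \<open>g\<close>.

  As a function of \<open>w\<close> that coefficient is a homogeneous polynomial of degree \<open>n\<close> whose coefficients
  are the Hermite coefficients of \<open>f\<close> with \<open>|\<alpha>| = n\<close> up to normalisation. In dimension one it is the
  Hermite coefficient itself; in dimension \<open>d \<ge> 2\<close> integrating the polynomial against a product
  Hermite polynomial and a Gaussian isolates a single coefficient at a cost of at most \<open>d\<^sup>n\<close>.
\<close>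

section \<open>Hermite polynomials\<close>

text \<open>Physicists' normalisation: up to sign, the recursion is the effect of differentiating
  \<open>p(t) * exp (- t^2)\<close>. The coefficient field is left open because the generating
  function is expanded at complex \<open>t\<close>, while orthogonality is a statement over the
  reals.\<close>

fun hermite_poly :: "nat \<Rightarrow> 'a::{real_normed_field} poly" where
  "hermite_poly 0 = 1"
| "hermite_poly (Suc n) = [:0, 2:] * hermite_poly n - pderiv (hermite_poly n)"

lemma deriv_funpow_gaussian:
  "(deriv ^^ n) (\<lambda>t::real. exp (- t\<^sup>2)) = (\<lambda>t. (-1) ^ n * poly (hermite_poly n) t * exp (- t\<^sup>2))"
proof (induction n)
  case (Suc n)
  have "deriv (\<lambda>t::real. (-1) ^ n * poly (hermite_poly n) t * exp (- t\<^sup>2)) t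
      = (-1) ^ Suc n * poly (hermite_poly (Suc n)) t * exp (- t\<^sup>2)" for t
    by (rule DERIV_imp_deriv)
       (auto intro!: derivative_eq_intros simp: algebra_simps)
  then show ?case using Suc by simp
qed simp

text \<open>The exponent is \<open>x^2 - (x - t)^2\<close>, so in \<open>t\<close> this is a
  constant times a reflected Gaussian, and the reflection cancels the signs \<open>(-1) ^ n\<close>.
  At \<open>t = 0\<close> the Taylor coefficients of the generating function can be read
  off.\<close>

lemma deriv_funpow_hermite_generating:
  fixes x :: "'a::{real_normed_field,banach}"
  shows "(deriv ^^ n) (\<lambda>t. exp (2 * x * t - t\<^sup>2))
      = (\<lambda>t. poly (hermite_poly n) (x - t) * exp (2 * x * t - t\<^sup>2))"
proof (induction n)
  case (Suc n)
  have "deriv (\<lambda>t. poly (hermite_poly n) (x - t) * exp (2 * x * t - t\<^sup>2)) t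
      = poly (hermite_poly (Suc n)) (x - t) * exp (2 * x * t - t\<^sup>2)" for t
    by (rule DERIV_imp_deriv)
       (auto intro!: derivative_eq_intros DERIV_chain2[OF poly_DERIV] simp: algebra_simps)
  then show ?case using Suc by simp
qed simp

text \<open>Appell property; it turns the defining recursion into the three-term recurrence and
  later evaluates the L2 norms.\<close>

lemma pderiv_hermite_poly:
  "pderiv (hermite_poly (Suc n) :: 'a::real_normed_field poly) = smult (2 * of_nat (Suc n)) (hermite_poly n)"
proof (induction n)
  case 0
  then show ?case by (simp add: pderiv_pCons)
next
  case (Suc n)
  have X: "pderiv [:0, 2::'a:] = [:2:]" by (simp add: pderiv_pCons)
  have "pderiv (hermite_poly (Suc (Suc n)) :: 'a poly) = pderiv ([:0, 2:] * hermite_poly (Suc n) - pderiv (hermite_poly (Suc n)))"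
    by (simp only: hermite_poly.simps)
  also have "\<dots> = [:0,2:] * pderiv (hermite_poly (Suc n)) + hermite_poly (Suc n) * [:2:]
         - pderiv (pderiv (hermite_poly (Suc n)))"
    by (simp only: pderiv_diff pderiv_mult X)
  also have "\<dots> = smult (2 * of_nat (Suc n)) ([:0,2:] * hermite_poly n - pderiv (hermite_poly n))
         + smult 2 (hermite_poly (Suc n))"
    unfolding Suc pderiv_smult by (simp add: algebra_simps smult_diff_right)
  also have "[:0,2:] * hermite_poly n - pderiv (hermite_poly n) = hermite_poly (Suc n)"
    by (simp only: hermite_poly.simps)
  finally show ?case by (simp add: algebra_simps flip: smult_add_left)
qed

lemma poly_hermite_poly_Suc_Suc:
  fixes x :: "'a::real_normed_field"
  shows "poly (hermite_poly (Suc (Suc n))) x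
     = 2 * x * poly (hermite_poly (Suc n)) x - 2 * of_nat (Suc n) * poly (hermite_poly n) x"
proof -
  have "hermite_poly (Suc (Suc n)) = [:0, 2::'a:] * hermite_poly (Suc n) - pderiv (hermite_poly (Suc n))"
    by (simp only: hermite_poly.simps)
  then show ?thesis by (simp only: pderiv_hermite_poly) (simp add: algebra_simps del: hermite_poly.simps)
qed

lemma poly_hermite_poly_of_real:
  "poly (hermite_poly n) (of_real x) = (of_real (poly (hermite_poly n) x) :: 'a :: real_normed_field)"
proof (induction n rule: induct_nat_012)
  case (ge2 n)
  then show ?case by (simp only: poly_hermite_poly_Suc_Suc) simp
qed simp_all

lemma hermite_poly_generating_sums:
  "(\<lambda>n. of_real (poly (hermite_poly n) x) / fact n * t ^ n) sums exp (2 * of_real x * t - t\<^sup>2)"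
  for t :: complex
proof -
  have "(\<lambda>t::complex. exp (2 * of_real x * t - t\<^sup>2)) holomorphic_on ball 0 (norm t + 1)"
    by (intro holomorphic_intros)
  from holomorphic_power_series[OF this, of t] show ?thesis
    by (simp add: deriv_funpow_hermite_generating poly_hermite_poly_of_real)
qed

text \<open>Cauchy's inequality for the generating function on the circle \<open>|t| = r\<close>.
  The radius stays free: a large one gives geometric convergence of the Bargmann series, radius 1
  gives integrability of the Hermite moments.\<close>

lemma hermite_poly_bound:
  fixes x r :: real
  assumes "r > 0"
  shows "\<bar>poly (hermite_poly n) x\<bar> / fact n * r ^ n \<le> exp (2 * \<bar>x\<bar> * r + r\<^sup>2)"
proof -
  let ?f = "\<lambda>t::complex. exp (2 * of_real x * t - t\<^sup>2)"
  have "norm ((deriv ^^ n) ?f 0) \<le> fact n * exp (2 * \<bar>x\<bar> * r + r\<^sup>2) / r ^ n"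
  proof (rule Cauchy_inequality)
    fix t :: complex assume t: "norm (0 - t) = r"
    have "norm (2 * of_real x * t - t\<^sup>2) \<le> 2 * \<bar>x\<bar> * r + r\<^sup>2"
      using t by (intro order_trans[OF norm_triangle_ineq4]) (simp add: norm_mult norm_power)
    then show "norm (?f t) \<le> exp (2 * \<bar>x\<bar> * r + r\<^sup>2)"
      using norm_exp order_trans by fastforce
  qed (use assms in \<open>auto intro!: holomorphic_intros continuous_intros\<close>)
  then have "\<bar>poly (hermite_poly n) x\<bar> \<le> fact n * exp (2 * \<bar>x\<bar> * r + r\<^sup>2) / r ^ n"
    by (simp add: deriv_funpow_hermite_generating poly_hermite_poly_of_real)
  then show ?thesis using assms by (simp add: field_simps)
qed

lemma hermite_fun_eq:
  "hermite_fun k x = (2 ^ k * fact k * sqrt pi) powr (-1/2) * exp (- x\<^sup>2 / 2) * poly (hermite_poly k) x"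
proof -
  have "exp (x\<^sup>2 / 2) * exp (- x\<^sup>2) = exp (- x\<^sup>2 / 2)"
    by (simp flip: exp_add)
  moreover have "(-1) ^ k * (-1) ^ k = (1::real)" by (simp flip: power_mult_distrib)
  ultimately show ?thesis
    unfolding hermite_fun_def deriv_funpow_gaussian by (simp add: ac_simps)
qed

section \<open>Integrals of polynomials against the Gaussian weight\<close>

lemma tendsto_poly_gaussian:
  fixes p :: "real poly"
  shows "((\<lambda>x. poly p x * exp (- x\<^sup>2)) \<longlongrightarrow> 0) at_top" "((\<lambda>x. poly p x * exp (- x\<^sup>2)) \<longlongrightarrow> 0) at_bot"
proof -
  have *: "((\<lambda>x. poly p x * exp (- x\<^sup>2)) \<longlongrightarrow> 0) at_top" for p :: "real poly"
  proof -
    have m: "((\<lambda>x::real. x ^ k * exp (- x\<^sup>2)) \<longlongrightarrow> 0) at_top" for k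
      by real_asymp
    have "((\<lambda>x. \<Sum>k\<le>degree p. coeff p k * (x ^ k * exp (- x\<^sup>2))) \<longlongrightarrow> (\<Sum>k\<le>degree p. coeff p k * 0)) at_top"
      by (intro tendsto_sum tendsto_mult tendsto_const m)
    then show ?thesis by (simp add: poly_altdef sum_distrib_right mult.assoc)
  qed
  show "((\<lambda>x. poly p x * exp (- x\<^sup>2)) \<longlongrightarrow> 0) at_top" by (rule *)
  show "((\<lambda>x. poly p x * exp (- x\<^sup>2)) \<longlongrightarrow> 0) at_bot"
    using *[of "pcompose p [:0, -1:]"] by (simp add: filterlim_at_bot_mirror poly_pcompose)
qed

lemma has_bochner_integral_gaussian:
  assumes "c > 0"
  shows "has_bochner_integral lborel (\<lambda>x::real. exp (- c * (x - m)\<^sup>2)) (sqrt (pi / c))"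
proof -
  have "has_bochner_integral lborel (\<lambda>x. sqrt (pi / c) * normal_density m (sqrt (1 / (2 * c))) x) (sqrt (pi / c) * 1)"
    using assms by (intro has_bochner_integral_mult_right)
       (simp add: has_bochner_integral_iff)
  moreover have "sqrt (pi / c) * normal_density m (sqrt (1 / (2 * c))) x = exp (- c * (x - m)\<^sup>2)" for x
    using assms by (simp add: normal_density_def field_simps real_sqrt_divide)
  ultimately show ?thesis by simp
qed

lemma integrable_poly_gaussian:
  fixes p :: "real poly"
  shows "integrable lborel (\<lambda>x. poly p x * exp (- x\<^sup>2))"
proof -
  have "integrable lborel (\<lambda>x. sqrt pi * (normal_density 0 (sqrt (1/2)) x * (x - 0) ^ k))" for k
    by (intro integrable_mult_right integrable_normal_moment) simp
  moreover have "sqrt pi * (normal_density 0 (sqrt (1/2)) x * (x - 0) ^ k) = x ^ k * exp (- x\<^sup>2)" for x k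
    by (simp add: normal_density_def)
  ultimately have "integrable lborel (\<lambda>x::real. x ^ k * exp (- x\<^sup>2))" for k by (simp only:)
  then have "integrable lborel (\<lambda>x. \<Sum>k\<le>degree p. coeff p k * (x ^ k * exp (- x\<^sup>2)))"
    by (intro Bochner_Integration.integrable_sum integrable_mult_right)
  then show ?thesis by (simp add: poly_altdef sum_distrib_right mult.assoc)
qed

text \<open>The integrand is the derivative of \<open>poly p x * exp (- x^2)\<close>, which vanishes
  at both ends of the line.\<close>

lemma integral_pderiv_gaussian:
  fixes p :: "real poly"
  shows "(LINT x|lborel. poly (pderiv p - [:0, 2:] * p) x * exp (- x\<^sup>2)) = 0"
proof -
  let ?F = "\<lambda>x. poly p x * exp (- x\<^sup>2)" and ?f = "\<lambda>x. poly (pderiv p - [:0, 2:] * p) x * exp (- x\<^sup>2)"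
  have "(LBINT x=-\<infinity>..\<infinity>. ?f x) = 0 - 0"
  proof (rule interval_integral_FTC_integrable)
    show "(?F has_vector_derivative ?f x) (at x)" for x
      unfolding has_real_derivative_iff_has_vector_derivative[symmetric]
      by (auto intro!: derivative_eq_intros simp: algebra_simps)
    show "isCont ?f x" for x by (intro continuous_intros)
    show "set_integrable lborel (einterval (-\<infinity>) \<infinity>) ?f"
      using integrable_poly_gaussian[of "pderiv p - [:0, 2:] * p"] by (simp add: set_integrable_def)
    show "((?F \<circ> real_of_ereal) \<longlongrightarrow> 0) (at_right (- \<infinity>))"
      unfolding ereal_tendsto_simps by (rule tendsto_poly_gaussian)
    show "((?F \<circ> real_of_ereal) \<longlongrightarrow> 0) (at_left \<infinity>)"
      unfolding ereal_tendsto_simps by (rule tendsto_poly_gaussian)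
  qed simp
  then show ?thesis by (simp add: interval_lebesgue_integral_def set_lebesgue_integral_def)
qed

text \<open>Integration by parts, since \<open>H_(k+1) exp (- x^2)\<close> is minus the derivative
  of \<open>H_k exp (- x^2)\<close>: one index is traded for one derivative of
  \<open>p\<close>.\<close>

lemma integral_hermite_poly_Suc:
  fixes p :: "real poly"
  shows "(LINT x|lborel. poly (p * hermite_poly (Suc k)) x * exp (- x\<^sup>2))
       = (LINT x|lborel. poly (pderiv p * hermite_poly k) x * exp (- x\<^sup>2))"
proof -
  have "poly (p * hermite_poly (Suc k)) x * exp (- x\<^sup>2) = poly (pderiv p * hermite_poly k) x * exp (- x\<^sup>2)
     - poly (pderiv (p * hermite_poly k) - [:0, 2:] * (p * hermite_poly k)) x * exp (- x\<^sup>2)" for x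
    by (simp add: pderiv_mult algebra_simps)
  then show ?thesis
    by (simp only: Bochner_Integration.integral_diff[OF integrable_poly_gaussian integrable_poly_gaussian]
        integral_pderiv_gaussian)
qed

lemma integral_gaussian: "(LINT x|lborel. exp (- x\<^sup>2)) = sqrt pi"
  using has_bochner_integral_gaussian[of 1 0] by (simp add: has_bochner_integral_iff)

text \<open>Repeated integration by parts: \<open>k\<close> derivatives kill a monomial of lower
  degree and turn \<open>x ^ k\<close> into \<open>fact k\<close>.\<close>

lemma integral_monom_hermite_poly:
  "m < k \<Longrightarrow> (LINT x::real|lborel. x ^ m * poly (hermite_poly k) x * exp (- x\<^sup>2)) = 0"
  "(LINT x::real|lborel. x ^ k * poly (hermite_poly k) x * exp (- x\<^sup>2)) = fact k * sqrt pi"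
proof -
  define I where "I p k = (LINT x::real|lborel. poly (p * hermite_poly k) x * exp (- x\<^sup>2))" for p :: "real poly" and k
  have I_Suc: "I p (Suc k) = I (pderiv p) k" for p k
    unfolding I_def by (rule integral_hermite_poly_Suc)
  have I_smult: "I (smult c p) k = c * I p k" for c p k
    unfolding I_def by (simp add: mult.assoc)
  have mon: "pderiv (monom 1 (Suc m)) = smult (real (Suc m)) (monom 1 m)" for m
    by (simp add: pderiv_monom smult_monom)
  have conv: "(LINT x::real|lborel. x ^ m * poly (hermite_poly k) x * exp (- x\<^sup>2)) = I (monom 1 m) k" for m k
    by (simp add: I_def poly_monom)
  have "m < k \<Longrightarrow> I (monom 1 m) k = 0" for m
  proof (induction k arbitrary: m)
    case (Suc k)
    show ?case
    proof (cases m)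
      case 0
      then show ?thesis unfolding I_Suc by (simp add: I_def pderiv_monom)
    next
      case m: (Suc m')
      then show ?thesis unfolding m I_Suc mon I_smult using Suc.IH[of m'] Suc.prems m by simp
    qed
  qed simp
  then show "m < k \<Longrightarrow> (LINT x::real|lborel. x ^ m * poly (hermite_poly k) x * exp (- x\<^sup>2)) = 0"
    by (simp add: conv)
  have "I (monom 1 k) k = fact k * sqrt pi"
  proof (induction k)
    case 0
    then show ?case by (simp add: I_def poly_monom integral_gaussian)
  next
    case (Suc k)
    then show ?case unfolding I_Suc mon I_smult by (simp add: algebra_simps)
  qed
  then show "(LINT x::real|lborel. x ^ k * poly (hermite_poly k) x * exp (- x\<^sup>2)) = fact k * sqrt pi"
    by (simp add: conv)
qed

lemma integral_hermite_poly_square: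
  "(LINT x::real|lborel. (poly (hermite_poly k) x)\<^sup>2 * exp (- x\<^sup>2)) = 2 ^ k * fact k * sqrt pi"
proof (induction k)
  case 0
  then show ?case by (simp add: integral_gaussian)
next
  case (Suc k)
  have "(LINT x::real|lborel. (poly (hermite_poly (Suc k)) x)\<^sup>2 * exp (- x\<^sup>2))
     = (LINT x::real|lborel. poly (hermite_poly (Suc k) * hermite_poly (Suc k)) x * exp (- x\<^sup>2))"
    by (simp only: poly_mult power2_eq_square)
  also have "\<dots> = (LINT x::real|lborel. poly (pderiv (hermite_poly (Suc k)) * hermite_poly k) x * exp (- x\<^sup>2))"
    by (rule integral_hermite_poly_Suc)
  also have "\<dots> = (LINT x::real|lborel. 2 * real (Suc k) * ((poly (hermite_poly k) x)\<^sup>2 * exp (- x\<^sup>2)))"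
    by (simp only: pderiv_hermite_poly) (simp add: power2_eq_square mult.assoc)
  also have "\<dots> = 2 * real (Suc k) * (2 ^ k * fact k * sqrt pi)"
    by (simp only: Suc integral_mult_right_zero)
  finally show ?case by (simp add: algebra_simps)
qed

section \<open>Hermite polynomials of an inner product, and Gaussian integrals\<close>

text \<open>Comparing coefficients of \<open>X^m\<close>, the equation determines
  \<open>(m + 1) F_(m+1)\<close> from the earlier coefficients, and \<open>m + 1\<close> is
  invertible in characteristic zero.\<close>

lemma fps_ode_unique:
  fixes F G :: "'a::field_char_0 fps"
  assumes "fps_nth F 0 = fps_nth G 0"
    and "fps_deriv F = A * F" and "fps_deriv G = A * G"
  shows "F = G"
proof (rule fps_ext)
  fix n show "fps_nth F n = fps_nth G n"
  proof (induction n rule: less_induct)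
    case (less n)
    show ?case
    proof (cases n)
      case (Suc m)
      have "of_nat (Suc m) * fps_nth H (Suc m) = (\<Sum>i=0..m. fps_nth A i * fps_nth H (m - i))"
        if "fps_deriv H = A * H" for H
        using arg_cong[OF that, of "\<lambda>H. fps_nth H m"] by (simp add: fps_mult_nth)
      from this[OF assms(2)] this[OF assms(3)]
      have "of_nat (Suc m) * fps_nth F (Suc m) = of_nat (Suc m) * fps_nth G (Suc m)"
        using less Suc by simp
      then show ?thesis unfolding Suc by (simp del: of_nat_Suc)
    qed (use assms in simp)
  qed
qed

text \<open>The Hermite generating function with \<open>t\<close> rescaled by \<open>w\<close>.
  Treating it as a formal series makes the product formula pure algebra, with no convergence to
  check.\<close>

definition hermite_fps :: "real \<Rightarrow> real \<Rightarrow> real fps" where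
  "hermite_fps x w = Abs_fps (\<lambda>n. poly (hermite_poly n) x * w ^ n / fact n)"

text \<open>The three-term recurrence as a first-order linear differential equation; its coefficient
  is the logarithmic derivative of \<open>exp (2xwt - w^2 t^2)\<close>.\<close>

lemma fps_deriv_hermite_fps:
  "fps_deriv (hermite_fps x w) = (fps_const (2 * (x * w)) - fps_const (2 * w\<^sup>2) * fps_X) * hermite_fps x w"
proof (rule fps_ext)
  fix n
  show "fps_nth (fps_deriv (hermite_fps x w)) n
      = fps_nth ((fps_const (2 * (x * w)) - fps_const (2 * w\<^sup>2) * fps_X) * hermite_fps x w) n"
  proof (cases n)
    case 0
    then show ?thesis by (simp add: hermite_fps_def algebra_simps)
  next
    case (Suc m)
    have fact: "real (Suc k) * (c / fact (Suc k)) = c / fact k" for k c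
      by (simp add: fact_Suc del: of_nat_Suc)
    have "fps_nth (fps_deriv (hermite_fps x w)) n = poly (hermite_poly (Suc (Suc m))) x * w ^ Suc (Suc m) / fact (Suc m)"
      using fact[of "Suc m"] by (simp add: Suc hermite_fps_def del: hermite_poly.simps fact_Suc of_nat_Suc)
    also have "\<dots> = 2 * (x * w) * (poly (hermite_poly (Suc m)) x * w ^ Suc m / fact (Suc m))
        - 2 * w\<^sup>2 * (real (Suc m) * (poly (hermite_poly m) x * w ^ m / fact (Suc m)))"
      unfolding poly_hermite_poly_Suc_Suc
      by (simp add: algebra_simps diff_divide_distrib power2_eq_square del: hermite_poly.simps fact_Suc of_nat_Suc)
    also have "\<dots> = fps_nth ((fps_const (2 * (x * w)) - fps_const (2 * w\<^sup>2) * fps_X) * hermite_fps x w) n"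
      unfolding fact by (simp add: Suc hermite_fps_def algebra_simps del: hermite_poly.simps fact_Suc)
    finally show ?thesis .
  qed
qed

text \<open>Both sides are \<open>exp (2t x\<bullet>w - t\<^sup>2 |w|\<^sup>2)\<close> as formal power series in \<open>t\<close>.\<close>

lemma hermite_fps_prod:
  fixes x w :: "real^'n"
  assumes "norm w = 1"
  shows "(\<Prod>j\<in>UNIV. hermite_fps (x $ j) (r * w $ j)) = hermite_fps (x \<bullet> w) r"
proof -
  \<comment> \<open>Logarithmic derivatives add over the factors; for \<open>norm w = 1\<close> the
    total depends on \<open>x\<close> and \<open>w\<close> only through
    \<open>x \<bullet> w\<close>.\<close>
  have *: "fps_deriv (\<Prod>j\<in>S. hermite_fps (x $ j) (r * w $ j))
      = (fps_const (2 * (\<Sum>j\<in>S. x $ j * (r * w $ j))) - fps_const (2 * (\<Sum>j\<in>S. (r * w $ j)\<^sup>2)) * fps_X)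
        * (\<Prod>j\<in>S. hermite_fps (x $ j) (r * w $ j))" if "finite S" for S
    using that
  proof (induction S)
    case (insert a S)
    define P where "P = (\<Prod>j\<in>S. hermite_fps (x $ j) (r * w $ j))"
    have add: "fps_const (2 * (a + b)) = fps_const (2 * a) + fps_const (2 * b)" for a b :: real
      by (simp add: distrib_left)
    have "fps_deriv (hermite_fps (x $ a) (r * w $ a) * P)
       = (fps_const (2 * (x $ a * (r * w $ a))) - fps_const (2 * (r * w $ a)\<^sup>2) * fps_X
          + (fps_const (2 * (\<Sum>j\<in>S. x $ j * (r * w $ j))) - fps_const (2 * (\<Sum>j\<in>S. (r * w $ j)\<^sup>2)) * fps_X))
          * (hermite_fps (x $ a) (r * w $ a) * P)"
      unfolding fps_deriv_mult insert.IH[folded P_def] fps_deriv_hermite_fps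
      by (simp only: algebra_simps)
    then show ?case
      unfolding P_def prod.insert[OF insert(1,2)] sum.insert[OF insert(1,2)] add
      by (simp only: algebra_simps)
  qed simp
  have 1: "(\<Sum>j\<in>UNIV. x $ j * (r * w $ j)) = (x \<bullet> w) * r"
    by (simp add: inner_vec_def sum_distrib_left algebra_simps)
  have "(\<Sum>j\<in>UNIV. (w $ j)\<^sup>2) = 1"
    using assms by (simp add: norm_vec_def L2_set_def)
  then have 2: "(\<Sum>j\<in>UNIV. (r * w $ j)\<^sup>2) = r\<^sup>2"
    by (simp add: power_mult_distrib flip: sum_distrib_left)
  show ?thesis
  proof (rule fps_ode_unique)
    show "fps_deriv (\<Prod>j\<in>UNIV. hermite_fps (x $ j) (r * w $ j)) =
      (fps_const (2 * ((x \<bullet> w) * r)) - fps_const (2 * r\<^sup>2) * fps_X) * (\<Prod>j\<in>UNIV. hermite_fps (x $ j) (r * w $ j))"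
      using *[of UNIV] unfolding 1 2 by simp
    show "fps_nth (\<Prod>j\<in>UNIV. hermite_fps (x $ j) (r * w $ j)) 0 = fps_nth (hermite_fps (x \<bullet> w) r) 0"
      by (simp add: hermite_fps_def fps_prod_nth')
  qed (rule fps_deriv_hermite_fps)
qed

text \<open>The coefficient of \<open>t^n\<close> in the product identity. A multi-index of degree
  \<open>n\<close> is represented by a multiset of size \<open>n\<close>, with
  \<open>count X j\<close> as its entry at \<open>j\<close>.\<close>

lemma hermite_poly_inner_expansion:
  fixes x w :: "real^'n"
  assumes "norm w = 1"
  shows "r ^ n * (poly (hermite_poly n) (x \<bullet> w) / fact n)
    = (\<Sum>X\<in>multisets_of_size UNIV n.
        (\<Prod>j\<in>UNIV. (r * w $ j) ^ count X j / fact (count X j)) * (\<Prod>j\<in>UNIV. poly (hermite_poly (count X j)) (x $ j)))"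
  using arg_cong[OF hermite_fps_prod[OF assms, of x r], of "\<lambda>F. fps_nth F n"]
  by (simp add: fps_prod_nth' hermite_fps_def field_simps flip: prod.distrib)

section \<open>Product integrals and Gaussian integrals in several variables\<close>

lemma lborel_prod_vec:
  fixes g :: "'n::finite \<Rightarrow> real \<Rightarrow> 'a::{real_normed_field,banach,second_countable_topology}"
  assumes int: "\<And>j. integrable lborel (g j)"
  shows "has_bochner_integral lborel (\<lambda>x::real^'n. \<Prod>j\<in>UNIV. g j (x $ j)) (\<Prod>j\<in>UNIV. LINT x|lborel. g j x)"
proof -
  interpret product_sigma_finite "\<lambda>_::real^'n. lborel :: real measure" ..
  let ?B = "Basis :: (real^'n) set"
  \<comment> \<open>Lebesgue measure on vectors is the image of a product measure indexed by
    \<open>Basis\<close>; \<open>e\<close> matches the index \<open>j\<close> with the basis vector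
    \<open>axis j 1\<close>, so that products over the two index sets can be exchanged.\<close>
  define e :: "'n \<Rightarrow> real^'n" where "e = (\<lambda>j. axis j 1)"
  have e: "inj e" "range e = ?B"
    by (auto simp: e_def inj_on_def axis_eq_axis Basis_vec_def)
  define G where "G = (\<lambda>b. g (inv e b))"
  have G: "integrable lborel (G b)" for b unfolding G_def by (rule int)
  have reindex: "(\<Prod>b\<in>?B. h b (inv e b)) = (\<Prod>j\<in>UNIV. h (e j) j)" for h :: "_ \<Rightarrow> _ \<Rightarrow> 'a"
    unfolding e(2)[symmetric] using e(1) by (simp add: prod.reindex)
  have comp: "(\<Sum>b\<in>?B. y b *\<^sub>R b) $ j = y (e j)" for y :: "real^'n \<Rightarrow> real" and j
  proof -
    have "(\<Sum>b\<in>?B. y b *\<^sub>R b) $ j = (\<Sum>b\<in>?B. y b *\<^sub>R b) \<bullet> e j"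
      by (simp add: e_def inner_axis)
    also have "\<dots> = y (e j)" using e(2) by (intro inner_sum_left_Basis) auto
    finally show ?thesis .
  qed
  have meas: "(\<lambda>x::real^'n. \<Prod>j\<in>UNIV. g j (x $ j)) \<in> borel_measurable borel"
  proof (intro borel_measurable_prod)
    fix j
    have [measurable]: "g j \<in> borel_measurable borel" using int[of j] by auto
    have [measurable]: "(\<lambda>x::real^'n. x $ j) \<in> borel_measurable borel"
      by (intro borel_measurable_continuous_onI continuous_intros)
    show "(\<lambda>x. g j (x $ j)) \<in> borel_measurable borel" by measurable
  qed
  have eq: "(\<Prod>j\<in>UNIV. g j ((\<Sum>b\<in>?B. y b *\<^sub>R b) $ j)) = (\<Prod>b\<in>?B. G b (y b))" for y
    unfolding comp using reindex[of "\<lambda>b j. g j (y b)"] by (simp add: G_def)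
  have m2: "(\<lambda>f. \<Sum>b\<in>?B. f b *\<^sub>R b) \<in> measurable (Pi\<^sub>M ?B (\<lambda>b. lborel)) borel"
    by measurable
  have "integrable lborel (\<lambda>x::real^'n. \<Prod>j\<in>UNIV. g j (x $ j))"
    unfolding lborel_eq[where 'a="real^'n"] integrable_distr_eq[OF m2 meas] eq
    by (intro product_integrable_prod G) simp
  moreover have "(LINT x|lborel. (\<Prod>j\<in>UNIV. g j ((x::real^'n) $ j))) = (\<Prod>j\<in>UNIV. LINT x|lborel. g j x)"
    unfolding lborel_eq[where 'a="real^'n"] integral_distr[OF m2 meas] eq
    using reindex[of "\<lambda>b j. LINT x|lborel. g j x"]
    by (subst product_integral_prod) (auto simp: G int G_def)
  ultimately show ?thesis by (simp add: has_bochner_integral_iff)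
qed

lemma norm_vec_square: "(norm x)\<^sup>2 = (\<Sum>j\<in>UNIV. (x $ j)\<^sup>2)" for x :: "real^'n"
  by (simp add: norm_vec_def L2_set_def sum_nonneg)

lemma has_bochner_integral_gaussian_vec:
  fixes m :: "real^'n"
  assumes "c > 0"
  shows "has_bochner_integral lborel (\<lambda>x. exp (- c * (norm (x - m))\<^sup>2)) (sqrt (pi / c) ^ CARD('n))"
proof -
  note G = has_bochner_integral_gaussian[OF assms]
  have "has_bochner_integral lborel (\<lambda>x::real^'n. \<Prod>j\<in>UNIV. exp (- c * (x $ j - m $ j)\<^sup>2))
      (\<Prod>j\<in>UNIV. LINT x|lborel. exp (- c * (x - m $ j)\<^sup>2))"
    using G by (intro lborel_prod_vec) (simp add: has_bochner_integral_iff)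
  also have "(\<Prod>j\<in>UNIV. LINT x|lborel. exp (- c * (x - m $ j)\<^sup>2)) = sqrt (pi / c) ^ CARD('n)"
    using G by (simp add: has_bochner_integral_iff)
  finally show ?thesis by (simp add: norm_vec_square sum_distrib_left exp_sum sum_negf[symmetric])
qed

text \<open>The real part \<open>p\<close> of \<open>w\<close> is handled by the characteristic
  function of the standard normal law. The imaginary part \<open>q\<close> is removed by completing
  the square, that is by translating \<open>x\<close> to \<open>q + x\<close>; the form
  \<open>q + 1 * x\<close> fits the affine substitution.\<close>

lemma has_bochner_integral_complex_gaussian:
  fixes w :: complex
  shows "has_bochner_integral lborel (\<lambda>x::real. exp (- of_real (x\<^sup>2) / 2 - \<i> * w * of_real x))
     (of_real (sqrt (2 * pi)) * exp (- w\<^sup>2 / 2))"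
proof -
  define p q where "p = Re w" and "q = Im w"
  have w: "w = of_real p + \<i> * of_real q" by (simp add: p_def q_def complex_eq_iff)
  have "integrable std_normal_distribution (\<lambda>x. iexp (- p * x))"
    by (intro finite_measure.integrable_const_bound[where B=1] prob_space.finite_measure)
       (auto simp: prob_space_normal_density)
  then have int: "integrable lborel (\<lambda>x. std_normal_density x *\<^sub>R iexp (- p * x))"
    by (subst (asm) integrable_density) auto
  have val: "(LINT x|lborel. std_normal_density x *\<^sub>R iexp (- p * x)) = exp (- (p\<^sup>2) / 2)"
    using fun_cong[OF char_std_normal_distribution, of "- p"]
    by (simp add: char_def integral_density)
  have "has_bochner_integral lborel
     (\<lambda>x. (of_real (sqrt (2 * pi)) * exp (q\<^sup>2 / 2 - \<i> * p * q)) * std_normal_density x *\<^sub>R iexp (- p * x))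
     (of_real (sqrt (2 * pi)) * exp (q\<^sup>2 / 2 - \<i> * p * q) * exp (- (p\<^sup>2) / 2))"
    using int val by (intro has_bochner_integral_mult_right) (auto simp: has_bochner_integral_iff)
  moreover have "(of_real (sqrt (2 * pi)) * exp (q\<^sup>2 / 2 - \<i> * p * q)) * std_normal_density x *\<^sub>R iexp (- p * x)
     = exp (- of_real ((q + 1 * x)\<^sup>2) / 2 - \<i> * w * of_real (q + 1 * x))" for x
  proof -
    have "complex_of_real (sqrt (2 * pi)) * of_real (std_normal_density x) = exp (- of_real (x\<^sup>2) / 2)"
      unfolding of_real_mult[symmetric] by (simp add: std_normal_density_def exp_of_real[symmetric])
    then have "(of_real (sqrt (2 * pi)) * exp (q\<^sup>2 / 2 - \<i> * p * q)) * std_normal_density x *\<^sub>R iexp (- p * x)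
       = exp (- of_real (x\<^sup>2) / 2) * exp (q\<^sup>2 / 2 - \<i> * p * q) * iexp (- p * x)"
      by (simp add: scaleR_conv_of_real)
    also have "\<dots> = exp (- of_real ((q + 1 * x)\<^sup>2) / 2 - \<i> * w * of_real (q + 1 * x))"
      unfolding exp_add[symmetric] w
      by (rule arg_cong[where f=exp]) (simp add: field_simps power2_eq_square)
    finally show ?thesis .
  qed
  ultimately have "has_bochner_integral lborel (\<lambda>x. exp (- of_real ((q + 1 * x)\<^sup>2) / 2 - \<i> * w * of_real (q + 1 * x)))
     (of_real (sqrt (2 * pi)) * exp (q\<^sup>2 / 2 - \<i> * p * q) * exp (- (p\<^sup>2) / 2))"
    by (simp only:)
  moreover have "of_real (sqrt (2 * pi)) * exp (q\<^sup>2 / 2 - \<i> * p * q) * exp (- (p\<^sup>2) / 2)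
     = of_real (sqrt (2 * pi)) * exp (- w\<^sup>2 / 2)"
    unfolding mult.assoc exp_add[symmetric] w
    by (simp add: algebra_simps power2_eq_square diff_divide_distrib add_divide_distrib flip: exp_of_real exp_add)
  ultimately show ?thesis
    by (subst lborel_has_bochner_integral_real_affine_iff[where c=1 and t=q]) (simp_all add: mult.assoc)
qed

lemma integral_complex_gaussian_vec:
  fixes w :: "'n::finite \<Rightarrow> complex"
  shows "(LINT x|lborel. exp (- of_real ((norm (x::real^'n))\<^sup>2) / 2 - \<i> * (\<Sum>j\<in>UNIV. w j * of_real (x $ j))))
     = of_real (sqrt (2 * pi)) ^ CARD('n) * exp (- (\<Sum>j\<in>UNIV. (w j)\<^sup>2) / 2)"
proof -
  note G = has_bochner_integral_complex_gaussian
  have "has_bochner_integral lborel (\<lambda>x::real^'n. \<Prod>j\<in>UNIV. exp (- of_real ((x $ j)\<^sup>2) / 2 - \<i> * w j * of_real (x $ j)))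
      (\<Prod>j\<in>UNIV. LINT x|lborel. exp (- of_real (x\<^sup>2) / 2 - \<i> * w j * of_real x))"
    using G by (intro lborel_prod_vec) (simp add: has_bochner_integral_iff)
  also have "(\<Prod>j\<in>UNIV. LINT x|lborel. exp (- of_real (x\<^sup>2) / 2 - \<i> * w j * of_real x))
     = of_real (sqrt (2 * pi)) ^ CARD('n) * exp (- (\<Sum>j\<in>UNIV. (w j)\<^sup>2) / 2)"
    using G by (simp add: has_bochner_integral_iff prod.distrib exp_sum[symmetric] sum_negf sum_divide_distrib)
  finally have "(LINT x|lborel. (\<Prod>j\<in>UNIV. exp (- of_real (((x::real^'n) $ j)\<^sup>2) / 2 - \<i> * w j * of_real (x $ j))))
     = of_real (sqrt (2 * pi)) ^ CARD('n) * exp (- (\<Sum>j\<in>UNIV. (w j)\<^sup>2) / 2)"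
    by (simp add: has_bochner_integral_iff)
  then show ?thesis
    by (simp add: norm_vec_square exp_sum[symmetric] sum_subtractf sum_negf sum_divide_distrib sum_distrib_left mult.assoc)
qed

section \<open>Growth of entire functions of order two\<close>

text \<open>\<open>F\<close> is damped by \<open>exp (- e * (z + 1) powr p)\<close>, whose exponent
  has order above two but keeps a controlled sign of its real part in the sector. The maximum
  principle is applied on a truncated sector, and then \<open>e\<close> tends to 0.\<close>

lemma phragmen_lindelof_sector:
  fixes F :: "complex \<Rightarrow> complex"
  assumes hol: "F holomorphic_on UNIV"
    and k: "0 < k" "k < 1" and A: "A \<ge> 0" and K: "K \<ge> 0"
    and growth: "\<And>w. norm (F w) \<le> K * exp (A * (norm w)\<^sup>2)"
    and edge: "\<And>w. Re w \<ge> 0 \<Longrightarrow> \<bar>Im w\<bar> = k * Re w \<Longrightarrow> norm (F w) \<le> K"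
    and w: "\<bar>Im w\<bar> \<le> k * Re w"
  shows "norm (F w) \<le> K"
proof -
  define b where "b = arctan k"
  have b: "0 < b" "b < pi / 4"
    using k arctan_less_iff[of k 1] by (simp_all add: b_def arctan_one)
  \<comment> \<open>The midpoint of 2 and \<open>pi / (2 * b)\<close>, a nonempty interval because
    \<open>b < pi / 4\<close>. Exceeding 2 beats the growth of \<open>F\<close>; staying below
    \<open>pi / (2 * b)\<close> keeps the cosine positive.\<close>
  define p where "p = 1 + pi / (4 * b)"
  have p: "p > 2" "p * b < pi / 2"
    using b by (simp_all add: p_def field_simps)
  define c where "c = cos (p * b)"
  have c: "c > 0" unfolding c_def using p b by (intro cos_gt_zero) auto
  \<comment> \<open>The shift by 1 keeps the vertex of the sector off the branch cut of the
    power.\<close>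
  define E where "E z = (z + 1) powr of_real p" for z :: complex
  have E_ge: "Re (E z) \<ge> c * norm (z + 1) powr p" and Re_ge: "Re z \<ge> 0" if z: "\<bar>Im z\<bar> \<le> k * Re z" for z
  proof -
    have "0 \<le> k * Re z" using z by linarith
    with k show 1: "Re z \<ge> 0" by (simp add: zero_le_mult_iff)
    have "\<bar>Im (z + 1)\<bar> \<le> k * Re (z + 1)" using z k by (simp add: distrib_left)
    then have "\<bar>Im (z + 1) / Re (z + 1)\<bar> \<le> k" using 1 by (simp add: field_simps)
    then have "arctan (Im (z + 1) / Re (z + 1)) \<le> arctan k" "arctan (- k) \<le> arctan (Im (z + 1) / Re (z + 1))"
      unfolding abs_le_iff arctan_le_iff by linarith+
    then have "\<bar>arctan (Im (z + 1) / Re (z + 1))\<bar> \<le> b"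
      unfolding b_def by (simp add: abs_le_iff arctan_minus)
    moreover have "Arg (z + 1) = arctan (Im (z + 1) / Re (z + 1))" using 1 by (intro arg_conv_arctan) simp
    ultimately have "\<bar>Arg (z + 1)\<bar> \<le> b" by simp
    then have "\<bar>p * Arg (z + 1)\<bar> \<le> p * b" using p by (simp add: abs_mult)
    then have "cos (p * b) \<le> cos \<bar>p * Arg (z + 1)\<bar>"
      using p b by (intro cos_monotone_0_pi_le) auto
    then have "c \<le> cos (p * Arg (z + 1))" by (simp add: c_def)
    moreover have nz: "z + 1 \<noteq> 0" using 1 by (auto simp: complex_eq_iff)
    then have "E z = exp (of_real (p * ln (norm (z + 1))) + \<i> * of_real (p * Arg (z + 1)))"
      by (simp add: E_def powr_def Ln_Arg algebra_simps)
    then have "Re (E z) = norm (z + 1) powr p * cos (p * Arg (z + 1))"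
      using nz by (simp add: Re_exp powr_def)
    ultimately show "Re (E z) \<ge> c * norm (z + 1) powr p"
      by (metis mult.commute mult_left_mono powr_ge_zero)
  qed
  have bound: "norm (F w) * exp (- e * Re (E w)) \<le> K" if e: "e > 0" for e
  proof -
    \<comment> \<open>\<open>R\<close> is taken so large that on the far side
      \<open>Re z = R\<close>, where \<open>(norm z)^2\<close> is at most \<open>2 * R^2\<close>,
      the damping outweighs the growth.\<close>
    have "filterlim (\<lambda>R::real. R powr (p - 2)) at_top at_top"
      using p by (intro real_powr_at_top) simp
    then have "eventually (\<lambda>R. R powr (p - 2) \<ge> 2 * A / (e * c)) at_top"
      by (simp add: filterlim_at_top)
    with eventually_ge_at_top[of "max 1 (Re w)"]
    have "eventually (\<lambda>R. R powr (p - 2) \<ge> 2 * A / (e * c) \<and> R \<ge> max 1 (Re w)) at_top"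
      by eventually_elim auto
    then obtain R where R: "R powr (p - 2) \<ge> 2 * A / (e * c)" "R \<ge> 1" "R \<ge> Re w"
      unfolding eventually_at_top_linorder by (meson max.bounded_iff order_refl)
    have "R powr p = R powr (p - 2) * R\<^sup>2"
      using powr_add[of R "p - 2" 2] R by simp
    with R have Rp: "2 * A * R\<^sup>2 \<le> e * c * R powr p"
      using e c by (simp add: field_simps mult_right_mono)
    define S where "S = {z. \<bar>Im z\<bar> \<le> k * Re z \<and> Re z \<le> R}"
    have clS: "closed S" unfolding S_def by (intro closed_Collect_conj closed_Collect_le continuous_intros)
    have bS: "bounded S"
    proof (rule boundedI)
      fix z assume z: "z \<in> S"
      then have "\<bar>Im z\<bar> \<le> k * Re z" "Re z \<le> R" "0 \<le> Re z" using Re_ge by (auto simp: S_def)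
      moreover have "k * Re z \<le> 1 * R" using k calculation by (intro mult_mono) auto
      ultimately show "norm z \<le> R + R" using cmod_le[of z] by linarith
    qed
    define f where "f z = F z * exp (- of_real e * E z)" for z
    have nf: "norm (f z) = norm (F z) * exp (- e * Re (E z))" for z
      by (simp add: f_def norm_mult)
    have holf: "f holomorphic_on {z. Re z > -1}"
      unfolding f_def E_def
      by (intro holomorphic_intros holomorphic_on_subset[OF hol]) (auto simp: complex_nonpos_Reals_iff)
    have sub: "S \<subseteq> {z. Re z > -1}" using Re_ge by (force simp: S_def)
    have int: "{z. \<bar>Im z\<bar> < k * Re z \<and> Re z < R} \<subseteq> interior S"
      by (rule interior_maximal) (auto simp: S_def intro!: open_Collect_conj open_Collect_less continuous_intros)
    have "norm (f w) \<le> K"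
    proof (rule maximum_modulus_frontier[where f = f and S = S and B = K])
      show "f holomorphic_on interior S"
        using holf interior_subset sub by (metis holomorphic_on_subset order_trans)
      show "continuous_on (closure S) f"
        using holf sub clS by (auto intro: holomorphic_on_imp_continuous_on holomorphic_on_subset)
      show "bounded S" by (rule bS)
      show "w \<in> S" using w R by (simp add: S_def)
      fix z assume "z \<in> frontier S"
      then have z: "z \<in> S" "z \<notin> interior S" using clS by (auto simp: frontier_def)
      then have zs: "\<bar>Im z\<bar> \<le> k * Re z" by (simp add: S_def)
      have Ez: "Re (E z) \<ge> c * norm (z + 1) powr p" "Re z \<ge> 0" using E_ge Re_ge zs by auto
      have "0 \<le> c * norm (z + 1) powr p" using c by simp
      with Ez have Ez0: "Re (E z) \<ge> 0" by linarith
      from z int have "\<bar>Im z\<bar> = k * Re z \<or> Re z = R" by (force simp: S_def)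
      then show "norm (f z) \<le> K"
      proof
        assume "\<bar>Im z\<bar> = k * Re z"
        then have "norm (F z) \<le> K" using edge Ez by blast
        moreover have "exp (- e * Re (E z)) \<le> 1" using e Ez0 by simp
        ultimately show ?thesis unfolding nf
          using mult_mono[of "norm (F z)" K "exp (- e * Re (E z))" 1] K by simp
      next
        assume zR: "Re z = R"
        have "k * R \<le> 1 * R" using k R by (intro mult_right_mono) auto
        then have "\<bar>Im z\<bar> \<le> \<bar>R\<bar>" using zs[unfolded zR] R by linarith
        then have "(Im z)\<^sup>2 \<le> R\<^sup>2" by (simp only: abs_le_square_iff)
        then have "(norm z)\<^sup>2 \<le> 2 * R\<^sup>2" by (simp add: cmod_power2 zR)
        then have "A * (norm z)\<^sup>2 \<le> A * (2 * R\<^sup>2)" using A by (rule mult_left_mono)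
        also have "\<dots> \<le> e * (c * R powr p)" using Rp by simp
        also have "\<dots> \<le> e * Re (E z)"
        proof (intro mult_left_mono)
          have "R \<le> norm (z + 1)" using zR complex_Re_le_cmod[of "z + 1"] by simp
          then have "c * R powr p \<le> c * norm (z + 1) powr p"
            using c R p by (intro mult_left_mono powr_mono2) auto
          then show "c * R powr p \<le> Re (E z)" using Ez by simp
        qed (use e in simp)
        finally have "A * (norm z)\<^sup>2 + - e * Re (E z) \<le> 0" by simp
        then have "exp (A * (norm z)\<^sup>2) * exp (- e * Re (E z)) \<le> 1" by (simp flip: exp_add)
        then have "K * exp (A * (norm z)\<^sup>2) * exp (- e * Re (E z)) \<le> K"
          using K by (simp add: mult.assoc mult_left_le)
        moreover have "norm (f z) \<le> K * exp (A * (norm z)\<^sup>2) * exp (- e * Re (E z))"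
          unfolding nf using growth by (intro mult_right_mono) auto
        ultimately show ?thesis by linarith
      qed
    qed
    then show ?thesis by (simp add: nf)
  qed
  have "((\<lambda>e. norm (F w) * exp (- e * Re (E w))) \<longlongrightarrow> norm (F w) * exp (- 0 * Re (E w))) (at_right 0)"
    by (intro tendsto_intros)
  then have "norm (F w) * exp (- 0 * Re (E w)) \<le> K"
  proof (rule tendsto_upperbound)
    show "\<forall>\<^sub>F e in at_right 0. norm (F w) * exp (- e * Re (E w)) \<le> K"
      by (rule eventually_at_rightI[of 0 1]) (auto intro: bound[simplified])
  qed simp
  then show ?thesis by simp
qed

text \<open>Chosen so that \<open>s - sector_decay s = 2 s^2 / (1 + s^2)\<close>, the growth rate in
  \<open>|t|^2\<close> that the better of the two growth bounds gives on the rays of slope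
  \<open>s\<close> and \<open>1/s\<close>.\<close>

definition sector_decay :: "real \<Rightarrow> real" where
  "sector_decay s = s * (1 - s)\<^sup>2 / (1 + s\<^sup>2)"

lemma sector_decay_pos: "0 < s \<Longrightarrow> s < 1 \<Longrightarrow> sector_decay s > 0"
  by (simp add: sector_decay_def add_pos_nonneg)

text \<open>The rotation by \<open>pi / 4\<close> moves a diagonal to the positive axis. Between the
  images of the rays of slope \<open>s\<close> and \<open>1/s\<close>, Phragmen-Lindelof yields the
  exponent \<open>s * Re (w^2)\<close>; in the rest of the quadrant the better of the two hypotheses
  suffices.\<close>

lemma sector_growth_bound:
  fixes g :: "complex \<Rightarrow> complex"
  assumes hol: "g holomorphic_on UNIV" and s: "0 < s" "s < 1" and K: "K \<ge> 0"
    and h1: "\<And>t. norm (g t) \<le> K * exp (s\<^sup>2 * (Re t)\<^sup>2 + (Im t)\<^sup>2)"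
    and h2: "\<And>t. norm (g t) \<le> K * exp ((Re t)\<^sup>2 + s\<^sup>2 * (Im t)\<^sup>2)"
    and w: "\<bar>Im w\<bar> \<le> Re w"
  shows "norm (g (cis (pi / 4) * w)) \<le> K * exp (s * (norm w)\<^sup>2 - sector_decay s * (Im w)\<^sup>2)"
proof -
  \<comment> \<open>The tangent of \<open>pi / 4 - arctan s\<close>, half the angle between the rays
    of slope \<open>s\<close> and \<open>1/s\<close>.\<close>
  define k where "k = (1 - s) / (1 + s)"
  have k: "0 < k" "k < 1" using s by (auto simp: k_def field_simps)
  have "Re (cis (pi / 4) * z) = sqrt 2 / 2 * (Re z - Im z)" "Im (cis (pi / 4) * z) = sqrt 2 / 2 * (Re z + Im z)" for z
    by (simp_all add: cos_45 sin_45 algebra_simps)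
  then have re: "(Re (cis (pi / 4) * z))\<^sup>2 = (Re z - Im z)\<^sup>2 / 2"
    and im: "(Im (cis (pi / 4) * z))\<^sup>2 = (Re z + Im z)\<^sup>2 / 2" for z
    by (simp_all only: power_mult_distrib power_divide) simp_all
  let ?u = "\<lambda>z. (Re z - Im z)\<^sup>2" and ?v = "\<lambda>z. (Re z + Im z)\<^sup>2"
  have b1: "norm (g (cis (pi / 4) * z)) \<le> K * exp ((s\<^sup>2 * ?u z + ?v z) / 2)" for z
    using h1[of "cis (pi / 4) * z"] unfolding re im by (simp add: add_divide_distrib)
  have b2: "norm (g (cis (pi / 4) * z)) \<le> K * exp ((?u z + s\<^sup>2 * ?v z) / 2)" for z
    using h2[of "cis (pi / 4) * z"] unfolding re im by (simp add: add_divide_distrib)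
  have s2: "s\<^sup>2 \<le> 1" using s by (simp add: power_le_one)
  show ?thesis
  proof (cases "\<bar>Im w\<bar> \<le> k * Re w")
    case True
    \<comment> \<open>Since \<open>(cis (pi / 4) * z)^2 = \<i> * z^2\<close>, the comparison
      function \<open>exp (s Im (t^2))\<close> becomes \<open>exp (s Re (z^2))\<close>, and
      \<open>F\<close> is the quotient by it in modulus.\<close>
    define F where "F z = g (cis (pi / 4) * z) * exp (- of_real s * z\<^sup>2)" for z
    have nF: "norm (F z) = norm (g (cis (pi / 4) * z)) * exp (- s * ((Re z)\<^sup>2 - (Im z)\<^sup>2))" for z
      by (simp add: F_def norm_mult Re_power2)
    have "norm (F w) \<le> K"
    proof (rule phragmen_lindelof_sector[OF _ k _ K _ _ True, where A = 2])
      have "(\<lambda>z. g (cis (pi / 4) * z)) holomorphic_on UNIV"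
        using holomorphic_on_compose[of "\<lambda>z. cis (pi / 4) * z" UNIV g] hol
        by (auto simp: o_def intro!: holomorphic_intros intro: holomorphic_on_subset)
      then show "F holomorphic_on UNIV" unfolding F_def by (intro holomorphic_intros)
      fix z
      have "(s\<^sup>2 * ?u z + ?v z) / 2 + - s * ((Re z)\<^sup>2 - (Im z)\<^sup>2) \<le> 2 * (norm z)\<^sup>2"
      proof -
        have "s\<^sup>2 * ?u z \<le> 1 * ?u z" using s2 by (intro mult_right_mono) auto
        moreover have "s * (Im z)\<^sup>2 \<le> 1 * (Im z)\<^sup>2" using s by (intro mult_right_mono) auto
        moreover have "s * (Re z)\<^sup>2 \<ge> 0" "(Re z)\<^sup>2 \<ge> 0" using s by simp_all
        moreover have "(norm z)\<^sup>2 = (Re z)\<^sup>2 + (Im z)\<^sup>2" by (rule cmod_power2)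
        moreover have "?u z + ?v z = 2 * (Re z)\<^sup>2 + 2 * (Im z)\<^sup>2" by (simp add: power2_eq_square algebra_simps)
        moreover have "(a + v) / 2 + (- c - - b) \<le> 2 * N"
          if "a \<le> 1 * u" "b \<le> 1 * q" "0 \<le> c" "0 \<le> p" "N = p + q" "u + v = 2 * p + 2 * q"
          for a b c p q u v N :: real
          using that by argo
        ultimately show ?thesis
          unfolding right_diff_distrib minus_mult_left[symmetric] by blast
      qed
      then have "exp ((s\<^sup>2 * ?u z + ?v z) / 2) * exp (- s * ((Re z)\<^sup>2 - (Im z)\<^sup>2)) \<le> exp (2 * (norm z)\<^sup>2)"
        by (simp flip: exp_add)
      then have "K * exp ((s\<^sup>2 * ?u z + ?v z) / 2) * exp (- s * ((Re z)\<^sup>2 - (Im z)\<^sup>2)) \<le> K * exp (2 * (norm z)\<^sup>2)"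
        using K by (simp add: mult.assoc mult_left_mono)
      moreover have "norm (F z) \<le> K * exp ((s\<^sup>2 * ?u z + ?v z) / 2) * exp (- s * ((Re z)\<^sup>2 - (Im z)\<^sup>2))"
        unfolding nF using b1 by (intro mult_right_mono) auto
      ultimately show "norm (F z) \<le> K * exp (2 * (norm z)\<^sup>2)" by linarith
    next
      fix z assume z: "Re z \<ge> 0" "\<bar>Im z\<bar> = k * Re z"
      have ks: "(1 + s) * k = 1 - s" using s by (simp add: k_def)
      have kk: "1 - k = s * (1 + k)" using ks by (simp add: algebra_simps)
      \<comment> \<open>On the upper edge \<open>Re z - Im z\<close> is \<open>s\<close> times
        \<open>Re z + Im z\<close>, which makes the exponent in \<open>b2\<close> equal to
        \<open>s * Re (z^2)\<close>; on the lower edge the roles are exchanged and \<open>b1\<close>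
        fits.\<close>
      have "norm (g (cis (pi / 4) * z)) \<le> K * exp (s * ((Re z)\<^sup>2 - (Im z)\<^sup>2))"
      proof (cases "Im z \<ge> 0")
        case True
        then have im': "Im z = k * Re z" using z by simp
        have "Re z - Im z = s * (Re z + Im z)" unfolding im' using kk by algebra
        then have "(?u z + s\<^sup>2 * ?v z) / 2 = s * ((Re z)\<^sup>2 - (Im z)\<^sup>2)" by algebra
        then show ?thesis using b2[of z] by simp
      next
        case False
        then have im': "Im z = - k * Re z" using z by simp
        have "Re z + Im z = s * (Re z - Im z)" unfolding im' using kk by algebra
        then have "(s\<^sup>2 * ?u z + ?v z) / 2 = s * ((Re z)\<^sup>2 - (Im z)\<^sup>2)" by algebra
        then show ?thesis using b1[of z] by simp
      qed
      then have "norm (F z) \<le> K * exp (s * ((Re z)\<^sup>2 - (Im z)\<^sup>2)) * exp (- s * ((Re z)\<^sup>2 - (Im z)\<^sup>2))"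
        unfolding nF by (intro mult_right_mono) auto
      then show "norm (F z) \<le> K" by (simp add: mult.assoc flip: exp_add)
    qed simp
    then have "norm (F w) * exp (s * ((Re w)\<^sup>2 - (Im w)\<^sup>2)) \<le> K * exp (s * ((Re w)\<^sup>2 - (Im w)\<^sup>2))"
      by (rule mult_right_mono) simp
    then have "norm (g (cis (pi / 4) * w)) \<le> K * exp (s * ((Re w)\<^sup>2 - (Im w)\<^sup>2))"
      unfolding nF mult.assoc exp_add[symmetric] by simp
    moreover have "s * ((Re w)\<^sup>2 - (Im w)\<^sup>2) \<le> s * (norm w)\<^sup>2 - sector_decay s * (Im w)\<^sup>2"
    proof -
      have "(1 - s)\<^sup>2 \<le> 1 + s\<^sup>2" using s by (simp add: power2_eq_square algebra_simps)
      then have "s * ((1 - s)\<^sup>2 / (1 + s\<^sup>2)) \<le> s * 1"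
        using s by (intro mult_left_mono) (auto simp: divide_le_eq_1 add_pos_nonneg)
      then have "sector_decay s \<le> s" by (simp add: sector_decay_def)
      then have "sector_decay s * (Im w)\<^sup>2 \<le> s * (Im w)\<^sup>2" by (rule mult_right_mono) simp
      moreover have "0 \<le> s * (Im w)\<^sup>2" using s by simp
      ultimately have "sector_decay s * (Im w)\<^sup>2 \<le> 2 * (s * (Im w)\<^sup>2)" by linarith
      then show ?thesis by (simp add: cmod_power2 algebra_simps)
    qed
    ultimately show ?thesis using K by (meson exp_le_cancel_iff mult_left_mono order_trans)
  next
    case False
    have s1: "1 + s\<^sup>2 > 0" by (simp add: add_pos_nonneg)
    \<comment> \<open>Beyond the edges one of the two squares is at most \<open>s^2\<close> times
      the other. Relative to \<open>norm w\<close> the exponent is then largest in the case of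
      equality, which is the rate encoded in \<open>sector_decay\<close>.\<close>
    have alg: "(a + s\<^sup>2 * b) / 2 \<le> s * (norm w)\<^sup>2 - sector_decay s * (Im w)\<^sup>2"
      if "a \<le> s\<^sup>2 * b" "(norm w)\<^sup>2 = (a + b) / 2" for a b
    proof -
      have "(1 - s\<^sup>2) * a \<le> (1 - s\<^sup>2) * (s\<^sup>2 * b)" using s2 that by (intro mult_left_mono) auto
      then have "(1 + s\<^sup>2) * (a + s\<^sup>2 * b) \<le> 2 * s\<^sup>2 * (a + b)" by (simp add: algebra_simps)
      then have "(a + s\<^sup>2 * b) / 2 \<le> 2 * s\<^sup>2 / (1 + s\<^sup>2) * (norm w)\<^sup>2"
        unfolding that(2) using s1 by (simp add: field_simps)
      also have "2 * s\<^sup>2 / (1 + s\<^sup>2) = s - sector_decay s"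
        using s1 by (simp add: sector_decay_def field_simps power2_eq_square)
      also have "(s - sector_decay s) * (norm w)\<^sup>2 \<le> s * (norm w)\<^sup>2 - sector_decay s * (Im w)\<^sup>2"
        using sector_decay_pos[OF s] by (simp add: cmod_power2 algebra_simps)
      finally show ?thesis .
    qed
    have n: "(norm w)\<^sup>2 = (?u w + ?v w) / 2" "(norm w)\<^sup>2 = (?v w + ?u w) / 2"
      unfolding cmod_power2 by (simp_all add: power2_eq_square algebra_simps)
    have kk: "\<bar>Im w\<bar> * (1 + s) > (1 - s) * Re w" using False s by (simp add: k_def field_simps)
    show ?thesis
    proof (cases "Im w \<ge> 0")
      case True
      have "Re w - Im w \<le> s * (Re w + Im w)" using kk True by (simp add: algebra_simps)
      then have "?u w \<le> (s * (Re w + Im w))\<^sup>2" using w by (intro power_mono) auto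
      then have "?u w \<le> s\<^sup>2 * ?v w" by (simp add: power_mult_distrib)
      from alg[OF this n(1)] b2[of w] K show ?thesis
        by (meson exp_le_cancel_iff mult_left_mono order_trans)
    next
      case False
      have "Re w + Im w \<le> s * (Re w - Im w)" using kk False by (simp add: algebra_simps)
      then have "?v w \<le> (s * (Re w - Im w))\<^sup>2" using w by (intro power_mono) auto
      then have "?v w \<le> s\<^sup>2 * ?u w" by (simp add: power_mult_distrib)
      from alg[OF this n(2)] b1[of w, unfolded add.commute[of "s\<^sup>2 * ?u w"]] K show ?thesis
        by (meson exp_le_cancel_iff mult_left_mono order_trans)
    qed
  qed
qed

text \<open>Here \<open>x\<close> measures the angle in turns and \<open>m\<close> points along a
  diagonal. Multiplication by \<open>\<i>\<close> exchanges the squares of real and imaginary part,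
  hence the two hypotheses, so every quadrant reduces to the first one.\<close>

lemma circle_growth_bound:
  fixes g :: "complex \<Rightarrow> complex"
  assumes hol: "g holomorphic_on UNIV" and s: "0 < s" "s < 1" and K: "K \<ge> 0" and r: "r \<ge> 0"
    and h1: "\<And>t. norm (g t) \<le> K * exp (s\<^sup>2 * (Re t)\<^sup>2 + (Im t)\<^sup>2)"
    and h2: "\<And>t. norm (g t) \<le> K * exp ((Re t)\<^sup>2 + s\<^sup>2 * (Im t)\<^sup>2)"
    and x: "\<bar>x - m\<bar> \<le> 1 / 8" and m: "m = (2 * real n + 1) / 8"
  shows "norm (g (of_real r * cis (2 * pi * x))) \<le> K * exp (s * r\<^sup>2) * exp (- sector_decay s * r\<^sup>2 * (x - m)\<^sup>2)"
proof -
  define h where "h t = g (\<i> ^ n * t)" for t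
  have "h holomorphic_on UNIV"
    using holomorphic_on_compose[of "\<lambda>z. \<i> ^ n * z" UNIV g] hol
    by (auto simp: o_def h_def[abs_def] intro!: holomorphic_intros intro: holomorphic_on_subset)
  have "\<forall>t. norm (h t) \<le> K * exp (s\<^sup>2 * (Re t)\<^sup>2 + (Im t)\<^sup>2) \<and> norm (h t) \<le> K * exp ((Re t)\<^sup>2 + s\<^sup>2 * (Im t)\<^sup>2)"
    unfolding h_def
  proof (induction n)
    case 0
    then show ?case using h1 h2 by simp
  next
    case (Suc n)
    show ?case
    proof
      fix t
      have eq: "\<i> ^ Suc n * t = \<i> ^ n * (\<i> * t)" by simp
      from Suc.IH[rule_format, of "\<i> * t"]
      show "norm (g (\<i> ^ Suc n * t)) \<le> K * exp (s\<^sup>2 * (Re t)\<^sup>2 + (Im t)\<^sup>2) \<and>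
         norm (g (\<i> ^ Suc n * t)) \<le> K * exp ((Re t)\<^sup>2 + s\<^sup>2 * (Im t)\<^sup>2)"
        unfolding eq by (simp add: add.commute del: power_Suc)
    qed
  qed
  define y where "y = 2 * pi * (x - m)"
  have "\<bar>y\<bar> = 2 * pi * \<bar>x - m\<bar>" by (simp add: y_def abs_mult)
  also have "\<dots> \<le> 2 * pi * (1 / 8)" using x by (intro mult_left_mono) auto
  finally have y: "\<bar>y\<bar> \<le> pi / 4" by simp
  have "cos (pi / 4) \<le> cos \<bar>y\<bar>" using y by (intro cos_monotone_0_pi_le) auto
  then have cy: "sqrt 2 / 2 \<le> cos y" by (simp add: cos_45)
  have "\<bar>sin y\<bar> = sin \<bar>y\<bar>" using y by (auto simp: abs_if sin_ge_zero intro: sin_ge_zero) (smt (verit) pi_gt_zero sin_ge_zero sin_minus)+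
  also have "sin \<bar>y\<bar> \<le> sin (pi / 4)" using y by (intro sin_monotone_2pi_le) auto
  finally have sy: "\<bar>sin y\<bar> \<le> sqrt 2 / 2" by (simp add: sin_45)
  \<comment> \<open>Decay in \<open>sin y\<close> is converted into decay in \<open>x - m\<close>:
    with \<open>cos y >= 1/2\<close> the tangent bound gives
    \<open>|sin y| >= |y| / 2 = pi * |x - m|\<close>.\<close>
  have "\<bar>y\<bar> \<le> \<bar>tan y\<bar>" using y pi_gt_zero by (intro abs_tan_ge) linarith
  also have "\<bar>tan y\<bar> = \<bar>sin y\<bar> / cos y" using cy by (simp add: tan_def abs_divide abs_of_pos less_le_trans[OF _ cy])
  finally have "\<bar>y\<bar> * cos y \<le> \<bar>sin y\<bar>" using less_le_trans[OF _ cy, of 0] by (simp add: field_simps)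
  moreover have "\<bar>y\<bar> * (1 / 2) \<le> \<bar>y\<bar> * cos y"
    using cy real_sqrt_ge_one[of 2] by (intro mult_left_mono) linarith+
  moreover have "\<bar>y\<bar> * (1 / 2) \<ge> \<bar>x - m\<bar>"
    using pi_ge_two mult_right_mono[of 1 pi "\<bar>x - m\<bar>"] by (simp add: y_def abs_mult)
  ultimately have "\<bar>x - m\<bar> \<le> \<bar>sin y\<bar>" by linarith
  then have sinsq: "(x - m)\<^sup>2 \<le> (sin y)\<^sup>2" by (simp add: abs_le_square_iff)
  define w where "w = of_real r * cis y"
  have w: "Re w = r * cos y" "Im w = r * sin y" "norm w = r" using r by (auto simp: w_def norm_mult)
  have wle: "\<bar>Im w\<bar> \<le> Re w"
    unfolding w using r sy cy by (auto simp: abs_mult intro!: mult_left_mono)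
  have "\<i> ^ n * (cis (pi / 4) * w) = of_real r * (cis (real n * (pi / 2)) * cis (pi / 4) * cis y)"
    unfolding w_def Complex.DeMoivre[symmetric] cis_pi_half by (simp add: mult_ac)
  also have "\<dots> = of_real r * cis (2 * pi * x)"
    unfolding cis_mult by (rule arg_cong[where f="\<lambda>a. of_real r * cis a"]) (simp add: y_def m field_simps)
  finally have "norm (g (of_real r * cis (2 * pi * x))) = norm (h (cis (pi / 4) * w))" by (simp add: h_def)
  also have "\<dots> \<le> K * exp (s * (norm w)\<^sup>2 - sector_decay s * (Im w)\<^sup>2)"
    using \<open>h holomorphic_on UNIV\<close> s K \<open>\<forall>t. _ t\<close> wle by (intro sector_growth_bound) auto
  also have "\<dots> \<le> K * exp (s * r\<^sup>2 + - sector_decay s * r\<^sup>2 * (x - m)\<^sup>2)"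
    unfolding w using K sinsq sector_decay_pos[OF s]
    by (intro mult_left_mono) (auto simp: power_mult_distrib mult_left_mono)
  finally show ?thesis by (simp add: exp_add mult.assoc flip: exp_add)
qed

text \<open>Cauchy's formula on the circle of radius \<open>r\<close>. Each diagonal contributes a
  Gaussian in the angle with rate \<open>sector_decay s * r^2\<close>, whose integral is of order
  \<open>1 / r\<close>; this is the gain of \<open>r ^ Suc n\<close> over the \<open>r ^ n\<close>
  of Cauchy's inequality.\<close>

lemma taylor_coeff_bound:
  fixes g :: "complex \<Rightarrow> complex"
  assumes hol: "g holomorphic_on UNIV" and s: "0 < s" "s < 1" and K: "K \<ge> 0" and r: "r > 0"
    and h1: "\<And>t. norm (g t) \<le> K * exp (s\<^sup>2 * (Re t)\<^sup>2 + (Im t)\<^sup>2)"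
    and h2: "\<And>t. norm (g t) \<le> K * exp ((Re t)\<^sup>2 + s\<^sup>2 * (Im t)\<^sup>2)"
  shows "norm ((deriv ^^ n) g 0 / fact n) \<le> K * (4 * sqrt (pi / sector_decay s)) * exp (s * r\<^sup>2) / r ^ Suc n"
proof -
  define d where "d = sector_decay s * r\<^sup>2"
  have d: "d > 0" using sector_decay_pos[OF s] r by (simp add: d_def)
  define G where "G k x = exp (- d * (x - (2 * real k + 1) / 8)\<^sup>2)" for k x
  define c where "c = 2 * pi / r ^ n * (K * exp (s * r\<^sup>2))"
  have c: "c \<ge> 0" using K r by (simp add: c_def)
  have G_int: "G k integrable_on {0..1}" for k
    unfolding G_def by (intro integrable_continuous_interval continuous_intros)
  have G_le: "integral {0..1} (G k) \<le> sqrt (pi / d)" for k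
  proof -
    have "(G k has_integral sqrt (pi / d)) UNIV"
      using has_bochner_integral_gaussian[OF d, of "(2 * real k + 1) / 8"]
        has_integral_integral_lborel[of "G k"]
      by (simp add: G_def[abs_def] has_bochner_integral_iff)
    then show ?thesis
      using integral_subset_le[of "{0..1}" UNIV "G k"] G_int[of k]
      by (auto simp: integral_unique has_integral_integrable G_def)
  qed
  let ?f = "\<lambda>x. g (circlepath 0 r x) / circlepath 0 r x ^ Suc n * vector_derivative (circlepath 0 r) (at x within {0..1})"
  have "((\<lambda>u. g u / (u - 0) ^ Suc n) has_contour_integral ((2 * pi * \<i>) / fact n * (deriv ^^ n) g 0)) (circlepath 0 r)"
    using hol r by (intro Cauchy_has_contour_integral_higher_derivative_circlepath)
      (auto intro: holomorphic_on_imp_continuous_on holomorphic_on_subset)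
  then have I: "(?f has_integral ((2 * pi * \<i>) / fact n * (deriv ^^ n) g 0)) {0..1}"
    by (simp add: has_contour_integral_def)
  \<comment> \<open>Rather than cutting the circle into arcs, the integrand is dominated everywhere
    by the sum of four Gaussians, each bounded by its integral over the whole line.\<close>
  have "norm (integral {0..1} ?f) \<le> integral {0..1} (\<lambda>x. c * (\<Sum>k<4. G k x))"
  proof (rule Henstock_Kurzweil_Integration.integral_norm_bound_integral)
    show "?f integrable_on {0..1}" using I by blast
    show "(\<lambda>x. c * (\<Sum>k<4. G k x)) integrable_on {0..1}"
      unfolding G_def by (intro integrable_continuous_interval continuous_intros)
    fix x :: real assume x: "x \<in> {0..1}"
    have circ: "circlepath 0 r x = of_real r * cis (2 * pi * x)"
      by (simp add: circlepath cis_conv_exp mult_ac)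
    have vd: "norm (vector_derivative (circlepath 0 r) (at x within {0..1})) = 2 * pi * r"
      using x r by (simp add: vector_derivative_circlepath01 norm_mult)
    have "norm (?f x) = norm (g (of_real r * cis (2 * pi * x))) / r ^ Suc n * (2 * pi * r)"
      unfolding norm_mult vd circ using r by (simp add: norm_divide norm_mult norm_power)
    also have "\<dots> = 2 * pi / r ^ n * norm (g (of_real r * cis (2 * pi * x)))"
      using r by (simp add: field_simps)
    finally have nf: "norm (?f x) = 2 * pi / r ^ n * norm (g (of_real r * cis (2 * pi * x)))" .
    have "\<exists>k<4. \<bar>x - (2 * real k + 1) / 8\<bar> \<le> 1 / 8"
    proof -
      consider "x \<le> 1/4" | "1/4 \<le> x" "x \<le> 1/2" | "1/2 \<le> x" "x \<le> 3/4" | "3/4 \<le> x" by linarith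
      then show ?thesis
      proof cases
        case 1 then show ?thesis using x by (intro exI[of _ 0]) (auto simp: abs_if)
      next
        case 2 then show ?thesis using x by (intro exI[of _ 1]) (auto simp: abs_if)
      next
        case 3 then show ?thesis using x by (intro exI[of _ 2]) (auto simp: abs_if)
      next
        case 4 then show ?thesis using x by (intro exI[of _ 3]) (auto simp: abs_if)
      qed
    qed
    then obtain k where k: "k < 4" "\<bar>x - (2 * real k + 1) / 8\<bar> \<le> 1 / 8" by blast
    have "norm (g (of_real r * cis (2 * pi * x))) \<le> K * exp (s * r\<^sup>2) * G k x"
      using circle_growth_bound[OF hol s K _ h1 h2 k(2) refl] r unfolding G_def d_def by simp
    then have "norm (?f x) \<le> 2 * pi / r ^ n * (K * exp (s * r\<^sup>2) * G k x)"
      unfolding nf using r by (intro mult_left_mono) auto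
    also have "\<dots> = c * G k x" by (simp add: c_def)
    also have "\<dots> \<le> c * (\<Sum>k<4. G k x)"
      using k c by (intro mult_left_mono member_le_sum) (auto simp: G_def)
    finally show "norm (?f x) \<le> c * (\<Sum>k<4. G k x)" .
  qed
  also have "\<dots> = c * (\<Sum>k<4. integral {0..1} (G k))"
    using G_int by (simp add: integral_sum)
  also have "\<dots> \<le> c * (\<Sum>k<4::nat. sqrt (pi / d))"
    using c G_le by (intro mult_left_mono sum_mono) auto
  finally have "norm ((2 * pi * \<i>) / fact n * (deriv ^^ n) g 0) \<le> c * (4 * sqrt (pi / d))"
    using I by (simp add: integral_unique)
  also have "sqrt (pi / d) = sqrt (pi / sector_decay s) / r"
    using r by (simp add: d_def real_sqrt_divide real_sqrt_mult)
  finally have "2 * pi * norm ((deriv ^^ n) g 0 / fact n) \<le> 2 * pi * (K * (4 * sqrt (pi / sector_decay s)) * exp (s * r\<^sup>2) / r ^ Suc n)"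
    by (simp add: norm_mult norm_divide c_def field_simps)
  then show ?thesis by (rule mult_left_le_imp_le) simp
qed

section \<open>Slices of the Bargmann transform\<close>

text \<open>The induction step amounts to \<open>(n + 1/2) * (ln (n + 1) - ln n) >= 1\<close>. The
  extra \<open>1/2\<close> has the true order: after a square root it costs
  \<open>n powr (1/4)\<close>, half of what the gain \<open>1/r\<close> pays back.\<close>

lemma fact_stirling_upper:
  assumes "n \<ge> 1"
  shows "fact n \<le> exp 1 * real n powr (real n + 1/2) * exp (- real n)"
  using assms
proof (induction n rule: dec_induct)
  case base
  then show ?case by (simp flip: exp_add)
next
  case (step n)
  have n: "real n \<ge> 1" using step by simp
  have "2 * (real (Suc n) - real n) / (real n + real (Suc n)) \<le> ln (real (Suc n)) - ln (real n)"
    using n by (intro ln_inverse_approx_ge) auto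
  then have "1 \<le> (real n + 1/2) * (ln (real (Suc n)) - ln (real n))"
    using n by (simp add: field_simps)
  then have "1 + (real n + 1/2) * ln (real n) \<le> (real n + 1/2) * ln (real (Suc n))"
    by (simp add: algebra_simps)
  then have "exp (1 + (real n + 1/2) * ln (real n)) \<le> exp ((real n + 1/2) * ln (real (Suc n)))"
    by simp
  then have *: "exp 1 * real n powr (real n + 1/2) \<le> real (Suc n) powr (real n + 1/2)"
    using n by (simp add: powr_def exp_add)
  have "fact (Suc n) = real (Suc n) * fact n" by simp
  also have "\<dots> \<le> real (Suc n) * (exp 1 * real n powr (real n + 1/2) * exp (- real n))"
    using step by (intro mult_left_mono) auto
  also have "\<dots> \<le> real (Suc n) * (real (Suc n) powr (real n + 1/2) * exp (- real n))"
    using * by (intro mult_left_mono mult_right_mono) auto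
  also have "\<dots> = exp 1 * (real (Suc n) powr 1 * real (Suc n) powr (real n + 1/2)) * exp (- real (Suc n))"
  proof -
    have "exp (- real n) = exp 1 * exp (- real (Suc n))" by (simp flip: exp_add)
    then show ?thesis by (simp only: powr_one mult_ac)
  qed
  also have "real (Suc n) powr 1 * real (Suc n) powr (real n + 1/2) = real (Suc n) powr (real (Suc n) + 1/2)"
    unfolding powr_add[symmetric] by (simp add: add_ac)
  finally show ?case .
qed

text \<open>In absolute value only \<open>Re z\<close> is left, and completing the square centres
  the real Gaussian at \<open>m\<close>. It serves twice: for \<open>f\<close> with
  \<open>z = t\<close> and for its Fourier transform with \<open>z = \<i> * t\<close>.\<close>

lemma gaussian_laplace_bound:
  fixes \<phi> :: "real^'n \<Rightarrow> complex" and w :: "real^'n" and z :: complex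
  assumes meas: "\<phi> \<in> borel_measurable borel"
    and bound: "\<And>x. norm (\<phi> x) \<le> C * exp (- a * (norm x)\<^sup>2 / 2)" and a: "a > -1" and w: "norm w = 1"
  shows "norm (LINT x|lborel. \<phi> x * exp (- of_real ((norm x)\<^sup>2) / 2 + 2 * z * of_real (x \<bullet> w)))
     \<le> C * sqrt (2 * pi / (1 + a)) ^ CARD('n) * exp (2 * (Re z)\<^sup>2 / (1 + a))"
proof -
  define b where "b = (1 + a) / 2"
  have b: "b > 0" using a by (simp add: b_def)
  define m where "m = (Re z / b) *\<^sub>R w"
  let ?f = "\<lambda>x. \<phi> x * exp (- of_real ((norm x)\<^sup>2) / 2 + 2 * z * of_real (x \<bullet> w))"
  let ?g = "\<lambda>x. C * exp (2 * (Re z)\<^sup>2 / (1 + a)) * exp (- b * (norm (x - m))\<^sup>2)"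
  have g: "has_bochner_integral lborel ?g (C * exp (2 * (Re z)\<^sup>2 / (1 + a)) * sqrt (pi / b) ^ CARD('n))"
    by (intro has_bochner_integral_mult_right has_bochner_integral_gaussian_vec b)
  have le: "norm (?f x) \<le> ?g x" for x
  proof -
    have "norm (?f x) = norm (\<phi> x) * exp (- (norm x)\<^sup>2 / 2 + 2 * Re z * (x \<bullet> w))"
      by (simp add: norm_mult)
    also have "\<dots> \<le> C * exp (- a * (norm x)\<^sup>2 / 2) * exp (- (norm x)\<^sup>2 / 2 + 2 * Re z * (x \<bullet> w))"
      by (intro mult_right_mono bound) simp
    also have "\<dots> = C * exp (- a * (norm x)\<^sup>2 / 2 + (- (norm x)\<^sup>2 / 2 + 2 * Re z * (x \<bullet> w)))"
      by (simp only: exp_add mult.assoc)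
    also have "- a * (norm x)\<^sup>2 / 2 + (- (norm x)\<^sup>2 / 2 + 2 * Re z * (x \<bullet> w))
       = 2 * (Re z)\<^sup>2 / (1 + a) + - b * (norm (x - m))\<^sup>2"
    proof -
      have ww: "w \<bullet> w = 1" using w by (simp add: dot_square_norm)
      have "(norm (x - m))\<^sup>2 = (norm x)\<^sup>2 - 2 * (Re z / b) * (x \<bullet> w) + (Re z / b)\<^sup>2"
        unfolding power2_norm_eq_inner m_def
        by (simp add: inner_diff_left inner_diff_right ww inner_commute power2_eq_square)
      then have "b * (norm (x - m))\<^sup>2 = b * (norm x)\<^sup>2 - 2 * Re z * (x \<bullet> w) + (Re z)\<^sup>2 / b"
        using b by (simp add: field_simps power2_eq_square)
      moreover have "2 * (Re z)\<^sup>2 / (1 + a) = (Re z)\<^sup>2 / b" by (simp add: b_def)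
      moreover have "b * (norm x)\<^sup>2 = (norm x)\<^sup>2 / 2 + a * (norm x)\<^sup>2 / 2" by (simp add: b_def field_simps)
      ultimately show ?thesis by simp
    qed
    finally show ?thesis by (simp only: exp_add mult.assoc)
  qed
  have fm: "?f \<in> borel_measurable lborel" using meas by measurable
  have f: "integrable lborel ?f"
  proof (rule Bochner_Integration.integrable_bound[OF _ fm])
    show "integrable lborel ?g" using g by (simp only: has_bochner_integral_iff)
    show "AE x in lborel. norm (?f x) \<le> norm (?g x)"
      unfolding real_norm_def by (intro AE_I2 order_trans[OF le abs_ge_self])
  qed
  have "norm (integral\<^sup>L lborel ?f) \<le> integral\<^sup>L lborel ?g"
    using f g le by (intro Bochner_Integration.integral_norm_bound_integral) (auto simp: has_bochner_integral_iff)
  also have "\<dots> = C * exp (2 * (Re z)\<^sup>2 / (1 + a)) * sqrt (pi / b) ^ CARD('n)"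
    using g by (simp only: has_bochner_integral_iff)
  also have "pi / b = 2 * pi / (1 + a)" by (simp add: b_def)
  finally show ?thesis by (simp add: mult_ac)
qed

text \<open>Up to normalisation, the Bargmann transform of \<open>f\<close> at the vector
  \<open>t w\<close>; for a unit vector \<open>w\<close> the bilinear square of \<open>t w\<close>
  is \<open>t^2\<close>. The kernel is a Gaussian times the Hermite generating function in
  \<open>x \<bullet> w\<close>.\<close>

definition bargmann_slice :: "(real^'n \<Rightarrow> complex) \<Rightarrow> real^'n \<Rightarrow> complex \<Rightarrow> complex" where
  "bargmann_slice f w t = exp (- t\<^sup>2) *
     (LINT x|lborel. f x * exp (- of_real ((norm x)\<^sup>2) / 2 + 2 * t * of_real (x \<bullet> w)))"

definition hermite_coeff :: "(real^'n \<Rightarrow> complex) \<Rightarrow> real^'n \<Rightarrow> nat \<Rightarrow> complex" where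
  "hermite_coeff f w n =
     (LINT x|lborel. f x * of_real (exp (- (norm x)\<^sup>2 / 2) * (poly (hermite_poly n) (x \<bullet> w) / fact n)))"

text \<open>Termwise integration of the generating function. Bounding the polynomials at a radius
  above \<open>2 * norm t\<close> leaves a factor \<open>(1/2) ^ n\<close>, and the Gaussian absorbs
  the growth in \<open>x\<close>.\<close>

lemma bargmann_slice_sums:
  fixes f :: "real^'n \<Rightarrow> complex"
  assumes f: "integrable lborel f" and w: "norm w = 1"
  shows "(\<lambda>n. hermite_coeff f w n * t ^ n) sums bargmann_slice f w t"
proof -
  have [measurable]: "f \<in> borel_measurable borel" using f by auto
  define r where "r = 2 * norm t + 1"
  have r: "r > 0" "norm t \<le> r / 2" by (auto simp: r_def add_nonneg_pos)
  define u where "u n x = f x * of_real (exp (- (norm x)\<^sup>2 / 2) * (poly (hermite_poly n) (x \<bullet> w) / fact n)) * t ^ n" for n x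
  have le: "norm (u n x) \<le> exp (3 * r\<^sup>2) * norm (f x) * (1 / 2) ^ n" for n x
  proof -
    have xw: "\<bar>x \<bullet> w\<bar> \<le> norm x" using Cauchy_Schwarz_ineq2[of x w] w by simp
    have "exp (- (norm x)\<^sup>2 / 2) * (\<bar>poly (hermite_poly n) (x \<bullet> w)\<bar> / fact n) * norm t ^ n
       \<le> exp (- (norm x)\<^sup>2 / 2) * (\<bar>poly (hermite_poly n) (x \<bullet> w)\<bar> / fact n) * (r / 2) ^ n"
      using r by (intro mult_left_mono power_mono) auto
    also have "\<dots> = exp (- (norm x)\<^sup>2 / 2) * (\<bar>poly (hermite_poly n) (x \<bullet> w)\<bar> / fact n * r ^ n) * (1 / 2) ^ n"
      by (simp add: power_divide)
    also have "\<dots> \<le> exp (- (norm x)\<^sup>2 / 2) * exp (2 * \<bar>x \<bullet> w\<bar> * r + r\<^sup>2) * (1 / 2) ^ n"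
      using r by (intro mult_right_mono mult_left_mono hermite_poly_bound) auto
    also have "\<dots> = exp (- (norm x)\<^sup>2 / 2 + (2 * \<bar>x \<bullet> w\<bar> * r + r\<^sup>2)) * (1 / 2) ^ n"
      by (simp only: exp_add)
    also have "\<dots> \<le> exp (3 * r\<^sup>2) * (1 / 2) ^ n"
    proof -
      have "2 * \<bar>x \<bullet> w\<bar> * r \<le> 2 * norm x * r" using xw r by (intro mult_right_mono) auto
      \<comment> \<open>This gives \<open>2 * norm x * r - (norm x)^2 / 2 <= 2 * r^2\<close>; the
        remaining \<open>r^2\<close> completes the constant \<open>3 * r^2\<close>.\<close>
      moreover have "0 \<le> (norm x - 2 * r)\<^sup>2" by simp
      ultimately have "- (norm x)\<^sup>2 / 2 + (2 * \<bar>x \<bullet> w\<bar> * r + r\<^sup>2) \<le> 3 * r\<^sup>2"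
        by (simp add: power2_eq_square algebra_simps)
      then show ?thesis by simp
    qed
    finally have "norm (f x) * (exp (- (norm x)\<^sup>2 / 2) * (\<bar>poly (hermite_poly n) (x \<bullet> w)\<bar> / fact n) * norm t ^ n)
        \<le> norm (f x) * (exp (3 * r\<^sup>2) * (1 / 2) ^ n)"
      by (rule mult_left_mono) simp
    then show ?thesis by (simp add: u_def norm_mult norm_power norm_divide abs_mult mult_ac)
  qed
  have um: "u n \<in> borel_measurable lborel" for n
  proof -
    have [measurable]: "poly (hermite_poly n) \<in> borel_measurable (borel :: real measure)"
      by (intro borel_measurable_continuous_onI continuous_intros)
    show ?thesis unfolding u_def by measurable
  qed
  have bi: "integrable lborel (\<lambda>x. exp (3 * r\<^sup>2) * norm (f x) * (1 / 2) ^ n)" for n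
    using f by (intro integrable_mult_left integrable_mult_right integrable_norm)
  have ui: "integrable lborel (u n)" for n
    by (rule Bochner_Integration.integrable_bound[OF bi[of n] um])
       (unfold real_norm_def, intro AE_I2 order_trans[OF le abs_ge_self])
  have sm: "summable (\<lambda>n. norm (u n x))" for x
    by (rule summable_comparison_test'[OF summable_mult[OF summable_geometric, of "1 / 2 :: real" "exp (3 * r\<^sup>2) * norm (f x)"]])
       (use le in auto)
  have smi: "summable (\<lambda>n. LINT x|lborel. norm (u n x))"
  proof (rule summable_comparison_test')
    show "summable (\<lambda>n. (LINT x|lborel. exp (3 * r\<^sup>2) * norm (f x)) * (1 / 2 :: real) ^ n)"
      by (intro summable_mult summable_geometric) simp
    show "norm (LINT x|lborel. norm (u n x)) \<le> (LINT x|lborel. exp (3 * r\<^sup>2) * norm (f x)) * (1 / 2) ^ n" for n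
    proof -
      have "(LINT x|lborel. norm (u n x)) \<le> (LINT x|lborel. exp (3 * r\<^sup>2) * norm (f x) * (1 / 2) ^ n)"
        using ui bi le by (intro integral_mono) auto
      then show ?thesis by (simp add: integral_nonneg_AE)
    qed
  qed
  have "(\<lambda>n. LINT x|lborel. u n x) sums (LINT x|lborel. (\<Sum>n. u n x))"
    using ui sm smi by (intro sums_integral) auto
  moreover have "(LINT x|lborel. u n x) = hermite_coeff f w n * t ^ n" for n
    by (simp add: u_def hermite_coeff_def)
  moreover have "(\<Sum>n. u n x) = exp (- t\<^sup>2) * (f x * exp (- of_real ((norm x)\<^sup>2) / 2 + 2 * t * of_real (x \<bullet> w)))" for x
  proof -
    have "(\<lambda>n. f x * of_real (exp (- (norm x)\<^sup>2 / 2)) * (of_real (poly (hermite_poly n) (x \<bullet> w)) / fact n * t ^ n))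
       sums (f x * of_real (exp (- (norm x)\<^sup>2 / 2)) * exp (2 * of_real (x \<bullet> w) * t - t\<^sup>2))"
      by (intro sums_mult hermite_poly_generating_sums)
    moreover have "f x * of_real (exp (- (norm x)\<^sup>2 / 2)) * (of_real (poly (hermite_poly n) (x \<bullet> w)) / fact n * t ^ n) = u n x" for n
      by (simp add: u_def)
    moreover have "f x * of_real (exp (- (norm x)\<^sup>2 / 2)) * exp (2 * of_real (x \<bullet> w) * t - t\<^sup>2)
       = exp (- t\<^sup>2) * (f x * exp (- of_real ((norm x)\<^sup>2) / 2 + 2 * t * of_real (x \<bullet> w)))"
    proof -
      have eq: "of_real (exp (- (norm x)\<^sup>2 / 2)) * exp (2 * of_real (x \<bullet> w) * t - t\<^sup>2)
         = exp (- t\<^sup>2) * exp (- of_real ((norm x)\<^sup>2) / 2 + 2 * t * of_real (x \<bullet> w))"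
        unfolding exp_of_real[symmetric] exp_add[symmetric] by (simp add: algebra_simps)
      show ?thesis unfolding mult.assoc[of "f x"] eq by (rule mult.left_commute)
    qed
    ultimately show ?thesis by (simp add: sums_iff)
  qed
  ultimately show ?thesis by (simp add: bargmann_slice_def)
qed

lemma bargmann_slice_holomorphic:
  fixes f :: "real^'n \<Rightarrow> complex"
  assumes "integrable lborel f" "norm w = 1"
  shows "bargmann_slice f w holomorphic_on UNIV"
proof -
  have "bargmann_slice f w holomorphic_on ball 0 (norm z + 1)" for z :: complex
    by (rule power_series_holomorphic[of 0 _ "hermite_coeff f w"]) (simp add: bargmann_slice_sums[OF assms])
  then have "bargmann_slice f w field_differentiable at z" for z
    using holomorphic_on_imp_differentiable_at[of "bargmann_slice f w" "ball 0 (norm z + 1)" z] by simp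
  then show ?thesis by (simp add: holomorphic_on_def)
qed

lemma hermite_coeff_eq_deriv:
  fixes f :: "real^'n \<Rightarrow> complex"
  assumes "integrable lborel f" "norm w = 1"
  shows "hermite_coeff f w n = (deriv ^^ n) (bargmann_slice f w) 0 / fact n"
proof -
  let ?F = "Abs_fps (hermite_coeff f w)"
  note sums = bargmann_slice_sums[OF assms]
  have "fps_conv_radius ?F \<ge> norm (1 :: complex)"
    unfolding fps_conv_radius_def using sums[of 1]
    by (intro conv_radius_geI) (auto simp: sums_iff)
  then have "fps_conv_radius ?F > 0"
    by (metis less_le_trans norm_one zero_less_one zero_ereal_def one_ereal_def ereal_less(2))
  moreover have "eval_fps ?F z = bargmann_slice f w z" for z
    using sums[of z] by (simp add: eval_fps_def sums_iff)
  ultimately have "bargmann_slice f w has_fps_expansion ?F"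
    by (simp add: has_fps_expansion_def)
  from fps_nth_fps_expansion[OF this] show ?thesis by simp
qed

text \<open>On the Bargmann side the Fourier transform is a rotation: the right-hand side is the
  slice of \<open>fourier f\<close> at \<open>\<i> * t\<close>. Fubini leaves a complex Gaussian
  integral in \<open>y\<close>, which reproduces the kernel of the slice of \<open>f\<close> up to
  factors free of \<open>x\<close>.\<close>

lemma bargmann_slice_fourier:
  fixes f :: "real^'n \<Rightarrow> complex"
  assumes f: "integrable lborel f" and w: "norm w = 1"
  shows "bargmann_slice f w t = exp (t\<^sup>2) *
     (LINT y|lborel. fourier f y * exp (- of_real ((norm y)\<^sup>2) / 2 + 2 * (\<i> * t) * of_real (y \<bullet> w)))"
proof -
  have [measurable]: "f \<in> borel_measurable borel" using f by auto
  define c where "c = complex_of_real ((2 * pi) powr (- real CARD('n) / 2))"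
  define E where "E y = exp (- of_real ((norm y)\<^sup>2) / 2 + 2 * (\<i> * t) * complex_of_real (y \<bullet> w))" for y :: "real^'n"
  have [measurable]: "E \<in> borel_measurable borel" unfolding E_def by measurable
  have E_norm: "norm (E y) = exp (2 * (Im t)\<^sup>2) * exp (- (1/2) * (norm (y - (- 2 * Im t) *\<^sub>R w))\<^sup>2)" for y
  proof -
    have ww: "w \<bullet> w = 1" using w by (simp add: dot_square_norm)
    have "(norm (y - (- 2 * Im t) *\<^sub>R w))\<^sup>2 = (norm y)\<^sup>2 + 4 * Im t * (y \<bullet> w) + 4 * (Im t)\<^sup>2"
      unfolding power2_norm_eq_inner
      by (simp add: inner_add_left inner_add_right ww inner_commute power2_eq_square)
    then show ?thesis by (simp add: E_def add_divide_distrib flip: exp_add)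
  qed
  have E_int: "integrable lborel (\<lambda>y. norm (E y))"
    unfolding E_norm using has_bochner_integral_gaussian_vec[of "1/2" "(- 2 * Im t) *\<^sub>R w"]
    by (intro integrable_mult_right) (simp add: has_bochner_integral_iff)
  define h where "h x y = exp (- \<i> * complex_of_real (y \<bullet> x)) * f x * E y" for x y
  have h_norm: "norm (h x y) = norm (f x) * norm (E y)" for x y
    by (simp add: h_def norm_mult)
  have h_meas: "case_prod h \<in> borel_measurable (lborel \<Otimes>\<^sub>M lborel)"
    unfolding h_def by measurable
  have h_int: "integrable (lborel \<Otimes>\<^sub>M lborel) (case_prod h)"
  proof (rule lborel_pair.Fubini_integrable[OF h_meas])
    show "integrable lborel (\<lambda>x. LINT y|lborel. norm (case (x, y) of (x, y) \<Rightarrow> h x y))"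
      using f by (simp add: h_norm)
    show "AE x in lborel. integrable lborel (\<lambda>y. case (x, y) of (x, y) \<Rightarrow> h x y)"
    proof (intro AE_I2)
      fix x :: "real^'n"
      have "integrable lborel (\<lambda>y. norm (f x) * norm (E y))" using E_int by (rule integrable_mult_right)
      moreover have "h x \<in> borel_measurable lborel" unfolding h_def by measurable
      ultimately have "integrable lborel (h x)"
        by (rule Bochner_Integration.integrable_bound) (simp add: h_norm)
      then show "integrable lborel (\<lambda>y. case (x, y) of (x, y) \<Rightarrow> h x y)" by simp
    qed
  qed
  have inner: "(LINT y|lborel. h x y)
      = f x * (of_real (sqrt (2 * pi)) ^ CARD('n) * exp (- of_real ((norm x)\<^sup>2) / 2 + 2 * t * of_real (x \<bullet> w) - 2 * t\<^sup>2))" for x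
  proof -
    \<comment> \<open>The linear terms of the Fourier kernel and of \<open>E\<close> merge into the
      complex frequency vector \<open>x - 2 t w\<close>.\<close>
    define v where "v j = complex_of_real (x $ j) - 2 * t * of_real (w $ j)" for j
    have "h x y = f x * exp (- of_real ((norm y)\<^sup>2) / 2 - \<i> * (\<Sum>j\<in>UNIV. v j * of_real (y $ j)))" for y
    proof -
      have v: "(\<Sum>j\<in>UNIV. v j * of_real (y $ j)) = of_real (y \<bullet> x) - 2 * t * of_real (y \<bullet> w)"
        by (simp add: v_def inner_vec_def sum_distrib_left sum_subtractf algebra_simps)
      show ?thesis
        unfolding v by (simp add: h_def E_def algebra_simps flip: exp_add)
    qed
    then have "(LINT y|lborel. h x y) = f x * (of_real (sqrt (2 * pi)) ^ CARD('n) * exp (- (\<Sum>j\<in>UNIV. (v j)\<^sup>2) / 2))"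
      by (simp only: integral_mult_right_zero integral_complex_gaussian_vec)
    also have "(\<Sum>j\<in>UNIV. (v j)\<^sup>2) = of_real ((norm x)\<^sup>2) - 4 * t * of_real (x \<bullet> w) + 4 * t\<^sup>2"
    proof -
      have "(\<Sum>j\<in>UNIV. (v j)\<^sup>2) = of_real (\<Sum>j\<in>UNIV. (x $ j)\<^sup>2) - 4 * t * of_real (\<Sum>j\<in>UNIV. x $ j * w $ j)
          + 4 * t\<^sup>2 * of_real (\<Sum>j\<in>UNIV. (w $ j)\<^sup>2)"
        by (simp add: v_def power2_eq_square algebra_simps sum_subtractf sum.distrib sum_distrib_left)
      then show ?thesis using w by (simp add: inner_vec_def flip: norm_vec_square)
    qed
    finally show ?thesis by (simp add: field_simps)
  qed
  have "fourier f y * E y = c * (LINT x|lborel. h x y)" for y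
    unfolding h_def integral_mult_left_zero fourier_def c_def by (rule mult.assoc)
  then have "(LINT y|lborel. fourier f y * E y) = (LINT y|lborel. c * (LINT x|lborel. h x y))"
    by simp
  also have "\<dots> = c * (LINT x|lborel. LINT y|lborel. h x y)"
    using lborel_pair.Fubini_integral[OF h_int] by simp
  also have "\<dots> = c * (LINT x|lborel. (of_real (sqrt (2 * pi)) ^ CARD('n) * exp (- 2 * t\<^sup>2)) *
       (f x * exp (- of_real ((norm x)\<^sup>2) / 2 + 2 * t * of_real (x \<bullet> w))))"
  proof -
    have "exp (z - 2 * t\<^sup>2) = exp (- 2 * t\<^sup>2) * exp z" for z by (simp flip: exp_add)
    then show ?thesis unfolding inner by (simp only: mult_ac)
  qed
  also have "\<dots> = (c * of_real (sqrt (2 * pi)) ^ CARD('n)) * (exp (- 2 * t\<^sup>2) *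
       (LINT x|lborel. f x * exp (- of_real ((norm x)\<^sup>2) / 2 + 2 * t * of_real (x \<bullet> w))))"
    by simp
  also have "c * of_real (sqrt (2 * pi)) ^ CARD('n) = 1"
  proof -
    have "sqrt (2 * pi) ^ CARD('n) = (2 * pi) powr (real CARD('n) / 2)"
      by (simp add: powr_half_sqrt[symmetric] powr_realpow[symmetric] powr_powr)
    then have "(2 * pi) powr (- real CARD('n) / 2) * sqrt (2 * pi) ^ CARD('n) = 1"
      by (simp flip: powr_add)
    then show ?thesis unfolding c_def by (metis of_real_1 of_real_mult of_real_power)
  qed
  finally have "exp (t\<^sup>2) * (LINT y|lborel. fourier f y * E y) = exp (t\<^sup>2) * exp (- 2 * t\<^sup>2) *
       (LINT x|lborel. f x * exp (- of_real ((norm x)\<^sup>2) / 2 + 2 * t * of_real (x \<bullet> w)))"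
    by (simp only: mult.assoc mult_1)
  also have "exp (t\<^sup>2) * exp (- 2 * t\<^sup>2) = exp (- t\<^sup>2)"
    by (simp flip: exp_add)
  finally show ?thesis by (simp add: bargmann_slice_def E_def)
qed

text \<open>With \<open>s = exp (- 2 * \<gamma>)\<close> and \<open>a = tanh (2 * \<gamma>)\<close>
  one has \<open>2 / (1 + a) = 1 + s^2\<close>. Together with the modulus of the factor
  \<open>exp (- t^2)\<close> or \<open>exp (t^2)\<close>, this turns the two decay conditions into
  the two growth bounds of \<open>taylor_coeff_bound\<close>.\<close>

lemma hermite_coeff_bound:
  fixes f :: "real^'n \<Rightarrow> complex"
  assumes g: "\<gamma> > 0" and f: "f \<in> hardy_class (tanh (2 * \<gamma>))"
  obtains C where "C > 0" "\<And>w n r. norm w = 1 \<Longrightarrow> r > 0 \<Longrightarrow>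
     norm (hermite_coeff f w n) \<le> C * exp (exp (- 2 * \<gamma>) * r\<^sup>2) / r ^ Suc n"
proof -
  define a where "a = tanh (2 * \<gamma>)"
  define s where "s = exp (- 2 * \<gamma>)"
  have s: "0 < s" "s < 1" using g by (auto simp: s_def)
  have "a = (1 - s\<^sup>2) / (1 + s\<^sup>2)"
    by (simp add: a_def s_def tanh_real_altdef power2_eq_square flip: exp_add)
  moreover have s2: "1 + s\<^sup>2 > 0" by (simp add: add_pos_nonneg)
  ultimately have a1: "1 + a = 2 / (1 + s\<^sup>2)" by (simp add: field_simps)
  then have a: "a > -1" using s2 by (smt (verit) divide_pos_pos)
  have sa: "2 * x / (1 + a) = s\<^sup>2 * x + x" for x using s2 unfolding a1 by (simp add: field_simps)
  from f obtain C where int: "integrable lborel f" and C: "C > 0"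
    and b1: "\<And>x. norm (f x) \<le> C * exp (- a * (norm x)\<^sup>2 / 2)"
    and b2: "\<And>x. norm (fourier f x) \<le> C * exp (- a * (norm x)\<^sup>2 / 2)"
    by (auto simp: hardy_class_def a_def)
  have fm [measurable]: "f \<in> borel_measurable borel" using int by auto
  have Fm: "fourier f \<in> borel_measurable borel"
    unfolding fourier_def by measurable
  define K where "K = C * sqrt (2 * pi / (1 + a)) ^ CARD('n)"
  have K: "K > 0" using C a by (simp add: K_def)
  have h1: "norm (bargmann_slice f w t) \<le> K * exp (s\<^sup>2 * (Re t)\<^sup>2 + (Im t)\<^sup>2)" if w: "norm w = 1" for w t
  proof -
    have "norm (bargmann_slice f w t) \<le> exp ((Im t)\<^sup>2 - (Re t)\<^sup>2) * (K * exp (2 * (Re t)\<^sup>2 / (1 + a)))"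
      unfolding bargmann_slice_def norm_mult K_def
      by (intro mult_mono gaussian_laplace_bound fm b1 a w) (auto simp: Re_power2)
    also have "\<dots> = K * exp (((Im t)\<^sup>2 - (Re t)\<^sup>2) + (s\<^sup>2 * (Re t)\<^sup>2 + (Re t)\<^sup>2))"
      unfolding sa exp_add by (simp only: mult_ac)
    finally show ?thesis by (simp add: add.commute)
  qed
  have h2: "norm (bargmann_slice f w t) \<le> K * exp ((Re t)\<^sup>2 + s\<^sup>2 * (Im t)\<^sup>2)" if w: "norm w = 1" for w t
  proof -
    have "norm (bargmann_slice f w t) \<le> exp ((Re t)\<^sup>2 - (Im t)\<^sup>2) * (K * exp (2 * (Re (\<i> * t))\<^sup>2 / (1 + a)))"
      unfolding bargmann_slice_fourier[OF int w] norm_mult K_def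
      by (intro mult_mono gaussian_laplace_bound Fm b2 a w) (auto simp: Re_power2)
    also have "\<dots> = K * exp (((Re t)\<^sup>2 - (Im t)\<^sup>2) + (s\<^sup>2 * (Re (\<i> * t))\<^sup>2 + (Re (\<i> * t))\<^sup>2))"
      unfolding sa exp_add by (simp only: mult_ac)
    finally show ?thesis by simp
  qed
  show thesis
  proof
    show "K * (4 * sqrt (pi / sector_decay s)) > 0" using K sector_decay_pos[OF s] by simp
    fix w :: "real^'n" and n and r :: real assume w: "norm w = 1" and r: "r > 0"
    show "norm (hermite_coeff f w n) \<le> K * (4 * sqrt (pi / sector_decay s)) * exp (exp (- 2 * \<gamma>) * r\<^sup>2) / r ^ Suc n"
      unfolding hermite_coeff_eq_deriv[OF int w] s_def[symmetric]
      using K by (intro taylor_coeff_bound bargmann_slice_holomorphic int w s r h1 h2) auto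
  qed
qed

section \<open>Coefficients of homogeneous polynomials\<close>

lemma gaussian_hermite_prod_integrals:
  fixes \<alpha> :: "'n::finite \<Rightarrow> nat"
  defines "H \<equiv> \<lambda>y::real^'n. \<Prod>j\<in>UNIV. poly (hermite_poly (\<alpha> j)) (y $ j)"
  shows integrable_hermite_square: "integrable lborel (\<lambda>y. (H y)\<^sup>2 * exp (- (norm y)\<^sup>2))"
    and integral_hermite_square: "(LINT y|lborel. (H y)\<^sup>2 * exp (- (norm y)\<^sup>2))
          = sqrt pi ^ CARD('n) * 2 ^ sum \<alpha> UNIV * (\<Prod>j\<in>UNIV. fact (\<alpha> j))"
    and integrable_monom_hermite: "integrable lborel (\<lambda>y. (\<Prod>j\<in>UNIV. (y $ j) ^ \<beta> j) * H y * exp (- (norm y)\<^sup>2))"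
    and integral_monom_hermite: "sum \<beta> UNIV = sum \<alpha> UNIV \<Longrightarrow>
          (LINT y|lborel. (\<Prod>j\<in>UNIV. (y $ j) ^ \<beta> j) * H y * exp (- (norm y)\<^sup>2))
          = (if \<beta> = \<alpha> then sqrt pi ^ CARD('n) * (\<Prod>j\<in>UNIV. fact (\<alpha> j)) else 0)"
proof -
  have E: "exp (- (norm y)\<^sup>2) = (\<Prod>j\<in>UNIV. exp (- (y $ j)\<^sup>2))" for y :: "real^'n"
    by (simp add: norm_vec_square sum_negf[symmetric] exp_sum)
  have 1: "has_bochner_integral lborel (\<lambda>y. (H y)\<^sup>2 * exp (- (norm y)\<^sup>2))
     (\<Prod>j\<in>UNIV. LINT x|lborel. (poly (hermite_poly (\<alpha> j)) x)\<^sup>2 * exp (- x\<^sup>2))"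
    unfolding E H_def prod_power_distrib prod.distrib[symmetric]
    using integrable_poly_gaussian[of "hermite_poly _ * hermite_poly _"]
    by (intro lborel_prod_vec) (simp add: power2_eq_square)
  then show "integrable lborel (\<lambda>y. (H y)\<^sup>2 * exp (- (norm y)\<^sup>2))" by (simp add: has_bochner_integral_iff)
  from 1 show "(LINT y|lborel. (H y)\<^sup>2 * exp (- (norm y)\<^sup>2))
          = sqrt pi ^ CARD('n) * 2 ^ sum \<alpha> UNIV * (\<Prod>j\<in>UNIV. fact (\<alpha> j))"
    by (simp add: has_bochner_integral_iff integral_hermite_poly_square prod.distrib power_sum)
  have 2: "has_bochner_integral lborel (\<lambda>y. (\<Prod>j\<in>UNIV. (y $ j) ^ \<beta> j) * H y * exp (- (norm y)\<^sup>2))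
     (\<Prod>j\<in>UNIV. LINT x|lborel. x ^ \<beta> j * poly (hermite_poly (\<alpha> j)) x * exp (- x\<^sup>2))"
    unfolding E H_def prod.distrib[symmetric]
    using integrable_poly_gaussian[of "monom 1 _ * hermite_poly _"]
    by (intro lborel_prod_vec) (simp add: poly_monom)
  then show "integrable lborel (\<lambda>y. (\<Prod>j\<in>UNIV. (y $ j) ^ \<beta> j) * H y * exp (- (norm y)\<^sup>2))"
    by (simp add: has_bochner_integral_iff)
  assume sum: "sum \<beta> UNIV = sum \<alpha> UNIV"
  from 2 have eq: "(LINT y|lborel. (\<Prod>j\<in>UNIV. (y $ j) ^ \<beta> j) * H y * exp (- (norm y)\<^sup>2))
     = (\<Prod>j\<in>UNIV. LINT x|lborel. x ^ \<beta> j * poly (hermite_poly (\<alpha> j)) x * exp (- x\<^sup>2))"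
    by (simp add: has_bochner_integral_iff)
  show "(LINT y|lborel. (\<Prod>j\<in>UNIV. (y $ j) ^ \<beta> j) * H y * exp (- (norm y)\<^sup>2))
          = (if \<beta> = \<alpha> then sqrt pi ^ CARD('n) * (\<Prod>j\<in>UNIV. fact (\<alpha> j)) else 0)"
  proof (cases "\<beta> = \<alpha>")
    case True
    then show ?thesis unfolding eq by (simp add: integral_monom_hermite_poly prod.distrib)
  next
    case False
    \<comment> \<open>At equal total degree, \<open>\<beta> \<noteq> \<alpha>\<close> forces some
      entry of \<open>\<beta>\<close> below that of \<open>\<alpha>\<close>, and that one factor of
      the product integral vanishes.\<close>
    have "\<exists>j. \<beta> j < \<alpha> j"
    proof (rule ccontr)
      assume "\<not> (\<exists>j. \<beta> j < \<alpha> j)"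
      then have ge: "\<alpha> j \<le> \<beta> j" for j by (simp add: not_less)
      moreover obtain i where "\<beta> i \<noteq> \<alpha> i" using False by (auto simp: fun_eq_iff)
      ultimately have "sum \<alpha> UNIV < sum \<beta> UNIV"
        by (intro sum_strict_mono_ex1) (auto simp: le_neq_implies_less intro!: exI[of _ i])
      with sum show False by simp
    qed
    then obtain j where "\<beta> j < \<alpha> j" ..
    then have "(LINT x::real|lborel. x ^ \<beta> j * poly (hermite_poly (\<alpha> j)) x * exp (- x\<^sup>2)) = 0"
      by (rule integral_monom_hermite_poly)
    then show ?thesis unfolding eq using False by (auto intro!: prod_zero)
  qed
qed

text \<open>A single term of the exponential series. The parameter \<open>c\<close> later decides
  how much of the Gaussian weight is spent on absorbing the power
  \<open>norm y ^ (2 * n)\<close>.\<close>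

lemma power_le_fact_exp:
  fixes x c :: real
  assumes "x \<ge> 0" "c > 0"
  shows "x ^ n \<le> fact n / c ^ n * exp (c * x)"
proof -
  have "(\<lambda>k. (c * x) ^ k /\<^sub>R fact k) sums exp (c * x)" by (rule exp_converges)
  then have "(c * x) ^ n /\<^sub>R fact n \<le> exp (c * x)"
    using assms sum_le_suminf[of "\<lambda>k. (c * x) ^ k /\<^sub>R fact k" "{n}"] by (simp add: sums_iff)
  then show ?thesis using assms by (simp add: field_simps power_mult_distrib)
qed

text \<open>A coefficient of a homogeneous polynomial is recovered by pairing with the product Hermite
  polynomial in Gaussian space, since the Hermite polynomial annihilates every other monomial of the
  same total degree; Cauchy--Schwarz then uses only the values of the polynomial on real vectors.\<close>

lemma homogeneous_coeff_bound:
  fixes A :: "'n::finite multiset \<Rightarrow> complex" and \<alpha> :: "'n \<Rightarrow> nat"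
  assumes P: "\<And>y::real^'n. norm (\<Sum>X\<in>multisets_of_size UNIV n. of_real (\<Prod>j\<in>UNIV. (y $ j) ^ count X j) * A X) \<le> M * norm y ^ n"
    and M: "M > 0" and X: "\<And>j. count X j = \<alpha> j" "size X = n" and c: "0 < c" "c < 1"
  shows "norm (A X) * (\<Prod>j\<in>UNIV. fact (\<alpha> j))
     \<le> M * sqrt (fact n * (2 / c) ^ n * (\<Prod>j\<in>UNIV. fact (\<alpha> j)) * (1 / sqrt (1 - c)) ^ CARD('n))"
proof -
  define P where "P y = (\<Sum>X\<in>multisets_of_size UNIV n. of_real (\<Prod>j\<in>UNIV. (y $ j) ^ count X j) * A X)" for y :: "real^'n"
  define H where "H y = (\<Prod>j\<in>UNIV. poly (hermite_poly (\<alpha> j)) (y $ j))" for y :: "real^'n"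
  define F where "F = (\<Prod>j\<in>UNIV. fact (\<alpha> j) :: real)"
  have F: "F > 0" unfolding F_def by (intro prod_pos) auto
  define p where "p = sqrt pi ^ CARD('n)"
  have p: "p > 0" by (simp add: p_def)
  have sum_X: "(\<Sum>j\<in>UNIV. count Y j) = n" if "Y \<in> multisets_of_size UNIV n" for Y :: "'n multiset"
  proof -
    have "(\<Sum>j\<in>UNIV. count Y j) = (\<Sum>j\<in>set_mset Y. count Y j)"
      by (rule sum.mono_neutral_right) (auto simp: not_in_iff)
    then show ?thesis using that by (simp add: multisets_of_size_def size_multiset_overloaded_eq)
  qed
  have X': "X \<in> multisets_of_size UNIV n" using X by (simp add: multisets_of_size_def)
  have cX: "count X = \<alpha>" using X by auto
  have n: "sum \<alpha> UNIV = n" using sum_X[OF X'] cX by simp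
  note I = integrable_monom_hermite[of _ \<alpha>, folded H_def]
  let ?m = "\<lambda>Y y. (\<Prod>j\<in>UNIV. (y $ j) ^ count Y j) * H y * exp (- (norm y)\<^sup>2)"
  have PH: "P y * of_real (H y * exp (- (norm y)\<^sup>2)) = (\<Sum>Y\<in>multisets_of_size UNIV n. A Y * of_real (?m Y y))" for y
    unfolding P_def sum_distrib_right by (simp add: mult_ac)
  have PH_int: "integrable lborel (\<lambda>y. P y * of_real (H y * exp (- (norm y)\<^sup>2)))"
    unfolding PH by (intro Bochner_Integration.integrable_sum integrable_mult_right integrable_of_real I)
  have "(LINT y|lborel. P y * of_real (H y * exp (- (norm y)\<^sup>2)))
     = (\<Sum>Y\<in>multisets_of_size UNIV n. LINT y|lborel. A Y * of_real (?m Y y))"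
    unfolding PH by (rule Bochner_Integration.integral_sum) (intro integrable_mult_right integrable_of_real I)
  also have "\<dots> = (\<Sum>Y\<in>multisets_of_size UNIV n. A Y * of_real (LINT y|lborel. ?m Y y))"
    by (simp only: integral_mult_right_zero integral_complex_of_real)
  also have "\<dots> = (\<Sum>Y\<in>multisets_of_size UNIV n. if Y = X then A X * of_real (p * F) else 0)"
  proof (rule sum.cong)
    fix Y :: "'n multiset" assume Y: "Y \<in> multisets_of_size UNIV n"
    have "count Y = \<alpha> \<longleftrightarrow> Y = X" unfolding cX[symmetric] by (simp add: multiset_eq_iff fun_eq_iff)
    then show "A Y * of_real (LINT y|lborel. ?m Y y) = (if Y = X then A X * of_real (p * F) else 0)"
      using integral_monom_hermite[of "count Y" \<alpha>, folded H_def F_def p_def] sum_X[OF Y] n by auto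
  qed simp
  also have "\<dots> = A X * of_real (p * F)" using X' by (simp add: sum.delta finite_multisets_of_size)
  finally have val: "(LINT y|lborel. P y * of_real (H y * exp (- (norm y)\<^sup>2))) = A X * of_real (p * F)" .
  \<comment> \<open>\<open>p * G\<close> is the integral of \<open>?g1\<close>, a majorant of
    \<open>norm y ^ (2 * n) * exp (- (norm y)^2)\<close>.\<close>
  define G where "G = fact n / c ^ n * (1 / sqrt (1 - c)) ^ CARD('n)"
  have G: "G > 0" using c by (simp add: G_def)
  \<comment> \<open>Cauchy-Schwarz is carried out as a weighted arithmetic-geometric mean
    inequality; this weight makes the two resulting integrals equal.\<close>
  define L where "L = sqrt (G / (2 ^ n * F))"
  have L: "L > 0" using G F by (simp add: L_def)
  let ?g1 = "\<lambda>y::real^'n. fact n / c ^ n * exp (- (1 - c) * (norm (y - 0))\<^sup>2)"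
  let ?g2 = "\<lambda>y. (H y)\<^sup>2 * exp (- (norm y)\<^sup>2)"
  have g1: "has_bochner_integral lborel ?g1 (fact n / c ^ n * sqrt (pi / (1 - c)) ^ CARD('n))"
    using c by (intro has_bochner_integral_mult_right has_bochner_integral_gaussian_vec) simp
  moreover have "sqrt (pi / (1 - c)) ^ CARD('n) = p * (1 / sqrt (1 - c)) ^ CARD('n)"
    by (simp add: p_def real_sqrt_divide power_divide)
  ultimately have g1: "has_bochner_integral lborel ?g1 (p * G)" by (simp add: G_def mult_ac)
  have g2: "has_bochner_integral lborel ?g2 (p * 2 ^ n * F)"
    using integrable_hermite_square[of \<alpha>] integral_hermite_square[of \<alpha>]
    unfolding has_bochner_integral_iff H_def F_def p_def n by simp
  have bnd: "has_bochner_integral lborel (\<lambda>y. M / 2 * (?g1 y / L + L * ?g2 y)) (M / 2 * (p * G / L + L * (p * 2 ^ n * F)))"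
    by (intro has_bochner_integral_mult_right has_bochner_integral_add has_bochner_integral_divide_zero g1 g2)
  have le: "norm (P y * of_real (H y * exp (- (norm y)\<^sup>2))) \<le> M / 2 * (?g1 y / L + L * ?g2 y)" for y
  proof -
    have "((norm y)\<^sup>2) ^ n \<le> fact n / c ^ n * exp (c * (norm y)\<^sup>2)"
      using c by (intro power_le_fact_exp) auto
    then have "(norm y ^ n)\<^sup>2 * exp (- (norm y)\<^sup>2) \<le> fact n / c ^ n * exp (c * (norm y)\<^sup>2) * exp (- (norm y)\<^sup>2)"
      by (intro mult_right_mono) (auto simp: power_mult[symmetric] mult.commute)
    also have "\<dots> = ?g1 y" by (simp add: algebra_simps mult.assoc flip: exp_add)
    finally have g: "(norm y ^ n)\<^sup>2 * exp (- (norm y)\<^sup>2) \<le> ?g1 y" .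
    have amgm: "a * b \<le> (a\<^sup>2 / L + L * b\<^sup>2) / 2" for a b :: real
    proof -
      have "0 \<le> (a - L * b)\<^sup>2 / L" using L by simp
      also have "\<dots> = a\<^sup>2 / L - 2 * a * b + L * b\<^sup>2"
        using L by (simp add: power2_eq_square field_simps)
      finally show ?thesis by simp
    qed
    have "norm (P y * of_real (H y * exp (- (norm y)\<^sup>2))) = norm (P y) * \<bar>H y\<bar> * exp (- (norm y)\<^sup>2)"
      by (simp add: norm_mult abs_mult)
    also have "\<dots> \<le> M * norm y ^ n * \<bar>H y\<bar> * exp (- (norm y)\<^sup>2)"
      using P[of y] by (intro mult_right_mono) (auto simp: P_def)
    also have "\<dots> = M * exp (- (norm y)\<^sup>2) * (norm y ^ n * \<bar>H y\<bar>)" by simp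
    also have "\<dots> \<le> M * exp (- (norm y)\<^sup>2) * (((norm y ^ n)\<^sup>2 / L + L * \<bar>H y\<bar>\<^sup>2) / 2)"
      using M by (intro mult_left_mono amgm) auto
    also have "\<dots> = M / 2 * ((norm y ^ n)\<^sup>2 * exp (- (norm y)\<^sup>2) / L + L * ?g2 y)"
      by (simp add: field_simps)
    also have "\<dots> \<le> M / 2 * (?g1 y / L + L * ?g2 y)"
      using g M L by (intro mult_left_mono add_right_mono divide_right_mono) auto
    finally show ?thesis .
  qed
  note bnd' = bnd[unfolded has_bochner_integral_iff]
  have "norm (LINT y|lborel. P y * of_real (H y * exp (- (norm y)\<^sup>2))) \<le> (LINT y|lborel. M / 2 * (?g1 y / L + L * ?g2 y))"
    by (rule Bochner_Integration.integral_norm_bound_integral[OF PH_int conjunct1[OF bnd']]) (rule le)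
  also have "\<dots> = M / 2 * (p * G / L + L * (p * 2 ^ n * F))" by (rule conjunct2[OF bnd'])
  also have "M / 2 * (p * G / L + L * (p * 2 ^ n * F)) = p * (M * sqrt (G * (2 ^ n * F)))"
  proof -
    have "G / L = sqrt (G * (2 ^ n * F))" "L * (2 ^ n * F) = sqrt (G * (2 ^ n * F))"
      unfolding L_def using G F by (simp_all add: real_sqrt_divide real_sqrt_mult field_simps)
    then have "M / 2 * (p * (G / L) + p * (L * (2 ^ n * F))) = p * (M * sqrt (G * (2 ^ n * F)))" by simp
    then show ?thesis by (simp add: mult_ac)
  qed
  finally have "p * (norm (A X) * F) \<le> p * (M * sqrt (G * (2 ^ n * F)))"
    unfolding val using p F by (simp add: norm_mult mult_ac abs_mult)
  then have "norm (A X) * F \<le> M * sqrt (G * (2 ^ n * F))" using p by (rule mult_left_le_imp_le)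
  moreover have "G * (2 ^ n * F) = fact n * (2 / c) ^ n * F * (1 / sqrt (1 - c)) ^ CARD('n)"
    by (simp add: G_def power_divide)
  ultimately show ?thesis by (simp only: F_def)
qed

section \<open>Hermite coefficients\<close>

text \<open>The radius with \<open>s * r^2 = n / 2\<close> minimises
  \<open>exp (s * r^2) / r ^ n\<close>. Stirling cancels \<open>exp (n / 2)\<close> and
  \<open>n powr (n / 2)\<close>; the remaining power of \<open>n\<close> is \<open>-1/2\<close> from
  the extra \<open>1 / r\<close> plus \<open>1/4\<close> from Stirling.\<close>

lemma hermite_coeff_bound_fact:
  fixes f :: "real^'n \<Rightarrow> complex"
  assumes g: "\<gamma> > 0" and f: "f \<in> hardy_class (tanh (2 * \<gamma>))"
  obtains C where "C > 0" "\<And>w n. norm w = 1 \<Longrightarrow> n \<ge> 1 \<Longrightarrow>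
     norm (hermite_coeff f w n) * sqrt (fact n) \<le> C * sqrt 2 ^ n * exp (- \<gamma> * real n) * real n powr (-1/4)"
proof -
  obtain C where C: "C > 0" and le: "\<And>w n r. norm w = 1 \<Longrightarrow> r > 0 \<Longrightarrow>
     norm (hermite_coeff f w n) \<le> C * exp (exp (- 2 * \<gamma>) * r\<^sup>2) / r ^ Suc n"
    using hermite_coeff_bound[OF assms] by blast
  define s where "s = exp (- 2 * \<gamma>)"
  have s: "s > 0" by (simp add: s_def)
  \<comment> \<open>The logarithm of \<open>2 * s\<close>. All factors are written as exponentials,
    so that the final identity is a comparison of exponents.\<close>
  define L where "L = ln 2 - 2 * \<gamma>"
  have L: "2 * s = exp L" by (simp add: s_def L_def exp_diff exp_minus field_simps)
  show thesis
  proof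
    show "C * exp (1 / 2 + L / 2) > 0" using C by simp
    fix w :: "real^'n" and n :: nat assume w: "norm w = 1" and n: "n \<ge> 1"
    have N: "real n > 0" using n by simp
    define r where "r = exp ((ln (real n) - L) / 2)"
    have "r\<^sup>2 = exp (ln (real n) - L)" by (simp add: r_def power2_eq_square flip: exp_add)
    also have "\<dots> = real n / (2 * s)" using N by (simp add: exp_diff L)
    finally have r2: "s * r\<^sup>2 = real n / 2" using s by simp
    have "r ^ Suc n = exp (real (Suc n) * ((ln (real n) - L) / 2))"
      unfolding r_def by (simp only: exp_of_nat_mult)
    then have 1: "norm (hermite_coeff f w n) \<le> C * exp (real n / 2) * exp (- (real (Suc n) * ((ln (real n) - L) / 2)))"
      using le[OF w, of r n] unfolding s_def[symmetric] r2 by (simp add: r_def exp_minus field_simps)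
    have "fact n \<le> exp 1 * exp ((real n + 1/2) * ln (real n)) * exp (- real n)"
      using fact_stirling_upper[OF n] N by (simp add: powr_def)
    also have "\<dots> = (exp ((1 + (real n + 1/2) * ln (real n) - real n) / 2))\<^sup>2"
      by (simp add: power2_eq_square flip: exp_add)
    finally have 2: "sqrt (fact n) \<le> exp ((1 + (real n + 1/2) * ln (real n) - real n) / 2)"
      by (simp add: real_le_lsqrt)
    have "norm (hermite_coeff f w n) * sqrt (fact n)
       \<le> C * exp (real n / 2) * exp (- (real (Suc n) * ((ln (real n) - L) / 2)))
          * exp ((1 + (real n + 1/2) * ln (real n) - real n) / 2)"
      using 1 2 C by (intro mult_mono) auto
    also have "\<dots> = C * exp (1/2 + L/2 + real n * (ln 2 / 2) + - \<gamma> * real n + (-1/4) * ln (real n))"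
      unfolding mult.assoc exp_add[symmetric] by (simp add: L_def field_simps)
    also have "\<dots> = C * exp (1/2 + L/2) * exp (real n * (ln 2 / 2)) * exp (- \<gamma> * real n) * exp ((-1/4) * ln (real n))"
      by (simp only: exp_add mult.assoc)
    also have "exp (real n * (ln 2 / 2)) = sqrt 2 ^ n"
    proof -
      have "exp (ln 2 / 2) = sqrt (2 :: real)" by (simp add: powr_def flip: powr_half_sqrt)
      then show ?thesis by (simp only: exp_of_nat_mult)
    qed
    also have "exp ((-1/4) * ln (real n)) = real n powr (-1/4)"
      using N by (simp add: powr_def)
    finally show "norm (hermite_coeff f w n) * sqrt (fact n)
       \<le> C * exp (1 / 2 + L / 2) * sqrt 2 ^ n * exp (- \<gamma> * real n) * real n powr (-1/4)" .
  qed
qed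

text \<open>The unnormalised Hermite coefficient, as it enters the slices;
  \<open>l2_inner_hermite_multi\<close> supplies the L2 factor.\<close>

definition hermite_moment :: "(real^'n \<Rightarrow> complex) \<Rightarrow> ('n \<Rightarrow> nat) \<Rightarrow> complex" where
  "hermite_moment f \<alpha> =
     (LINT x|lborel. f x * of_real (exp (- (norm x)\<^sup>2 / 2) * (\<Prod>j\<in>UNIV. poly (hermite_poly (\<alpha> j)) (x $ j))))"

lemma integrable_hermite_moment:
  fixes f :: "real^'n \<Rightarrow> complex"
  assumes f: "integrable lborel f"
  shows "integrable lborel (\<lambda>x. f x * of_real (exp (- (norm x)\<^sup>2 / 2) * (\<Prod>j\<in>UNIV. poly (hermite_poly (\<alpha> j)) (x $ j))))"
    (is "integrable lborel ?g")
proof (rule Bochner_Integration.integrable_bound)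
  have [measurable]: "f \<in> borel_measurable borel" using f by auto
  \<comment> \<open>In each coordinate \<open>- y^2 / 2 + 2 * |y| + 1\<close> has maximum 3,
    attained at \<open>|y| = 2\<close>; the polynomial bound is used at radius 1.\<close>
  define K where "K = (\<Prod>j\<in>UNIV. fact (\<alpha> j) * exp 3 :: real)"
  show "integrable lborel (\<lambda>x. K * norm (f x))" using f by (intro integrable_mult_right integrable_norm)
  have "(\<lambda>x::real^'n. \<Prod>j\<in>UNIV. poly (hermite_poly (\<alpha> j)) (x $ j)) \<in> borel_measurable borel"
    by (intro borel_measurable_continuous_onI continuous_intros)
  then show "?g \<in> borel_measurable lborel" by measurable
  have le: "exp (- (norm x)\<^sup>2 / 2) * \<bar>\<Prod>j\<in>UNIV. poly (hermite_poly (\<alpha> j)) (x $ j)\<bar> \<le> K" for x :: "real^'n"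
  proof -
    have "exp (- (norm x)\<^sup>2 / 2) * \<bar>\<Prod>j\<in>UNIV. poly (hermite_poly (\<alpha> j)) (x $ j)\<bar>
        = (\<Prod>j\<in>UNIV. exp (- (x $ j)\<^sup>2 / 2) * \<bar>poly (hermite_poly (\<alpha> j)) (x $ j)\<bar>)"
      by (simp add: norm_vec_square prod.distrib abs_prod exp_sum[symmetric] sum_negf sum_divide_distrib)
    also have "\<dots> \<le> K" unfolding K_def
    proof (intro prod_mono conjI)
      fix j
      let ?y = "x $ j"
      have "\<bar>poly (hermite_poly (\<alpha> j)) ?y\<bar> \<le> fact (\<alpha> j) * exp (2 * \<bar>?y\<bar> + 1)"
        using hermite_poly_bound[of 1 "\<alpha> j" ?y] by (simp add: field_simps)
      then have "exp (- ?y\<^sup>2 / 2) * \<bar>poly (hermite_poly (\<alpha> j)) ?y\<bar> \<le> exp (- ?y\<^sup>2 / 2) * (fact (\<alpha> j) * exp (2 * \<bar>?y\<bar> + 1))"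
        by (rule mult_left_mono) simp
      also have "\<dots> = fact (\<alpha> j) * exp (- ?y\<^sup>2 / 2 + (2 * \<bar>?y\<bar> + 1))"
        unfolding exp_add by (simp only: mult_ac)
      also have "\<dots> \<le> fact (\<alpha> j) * exp 3"
      proof -
        have "0 \<le> (\<bar>?y\<bar> - 2)\<^sup>2" by simp
        then have "- ?y\<^sup>2 / 2 + (2 * \<bar>?y\<bar> + 1) \<le> 3" by (simp add: power2_diff)
        then show ?thesis by simp
      qed
      finally show "exp (- ?y\<^sup>2 / 2) * \<bar>poly (hermite_poly (\<alpha> j)) ?y\<bar> \<le> fact (\<alpha> j) * exp 3" .
    qed simp
    finally show ?thesis .
  qed
  have "norm (?g x) \<le> norm (K * norm (f x))" for x
  proof -
    have "norm (?g x) = norm (f x) * (exp (- (norm x)\<^sup>2 / 2) * \<bar>\<Prod>j\<in>UNIV. poly (hermite_poly (\<alpha> j)) (x $ j)\<bar>)"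
      unfolding norm_mult norm_of_real by (simp add: abs_mult)
    also have "\<dots> \<le> norm (f x) * K" by (intro mult_left_mono le) simp
    also have "\<dots> \<le> norm (K * norm (f x))" by (simp add: abs_mult mult.commute mult_right_mono)
    finally show ?thesis .
  qed
  then show "AE x in lborel. norm (?g x) \<le> norm (K * norm (f x))" by (rule AE_I2)
qed

lemma l2_inner_hermite_multi:
  fixes f :: "real^'n \<Rightarrow> complex"
  shows "norm (l2_inner f (\<lambda>x. complex_of_real (hermite_multi \<alpha> x)))
    = norm (hermite_moment f \<alpha>) / sqrt (2 ^ multi_abs \<alpha> * (\<Prod>j\<in>UNIV. fact (\<alpha> j)) * sqrt pi ^ CARD('n))"
proof -
  define c where "c = (\<Prod>j\<in>UNIV. (2 ^ \<alpha> j * fact (\<alpha> j) * sqrt pi) powr (-1/2))"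
  have "f x * cnj (complex_of_real (hermite_multi \<alpha> x))
     = of_real c * (f x * of_real (exp (- (norm x)\<^sup>2 / 2) * (\<Prod>j\<in>UNIV. poly (hermite_poly (\<alpha> j)) (x $ j))))" for x
  proof -
    have "hermite_multi \<alpha> x = c * (\<Prod>j\<in>UNIV. exp (- (x $ j)\<^sup>2 / 2)) * (\<Prod>j\<in>UNIV. poly (hermite_poly (\<alpha> j)) (x $ j))"
      by (simp add: hermite_multi_def hermite_fun_eq prod.distrib c_def)
    also have "(\<Prod>j\<in>UNIV. exp (- (x $ j)\<^sup>2 / 2)) = exp (- (norm x)\<^sup>2 / 2)"
      by (simp add: norm_vec_square exp_sum[symmetric] sum_negf sum_divide_distrib)
    finally show ?thesis by (simp add: mult_ac)
  qed
  then have "l2_inner f (\<lambda>x. complex_of_real (hermite_multi \<alpha> x)) = of_real c * hermite_moment f \<alpha>"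
    unfolding l2_inner_def hermite_moment_def by (simp only: integral_mult_right_zero)
  moreover have "c = 1 / sqrt (2 ^ multi_abs \<alpha> * (\<Prod>j\<in>UNIV. fact (\<alpha> j)) * sqrt pi ^ CARD('n))"
  proof -
    have "c = (\<Prod>j\<in>UNIV. 2 ^ \<alpha> j * fact (\<alpha> j) * sqrt pi) powr (-1/2)"
      unfolding c_def by (rule prod_powr_distrib[symmetric])
    also have "\<dots> = 1 / sqrt (\<Prod>j\<in>UNIV. 2 ^ \<alpha> j * fact (\<alpha> j) * sqrt pi)"
      by (simp add: powr_minus_divide powr_half_sqrt prod_nonneg)
    finally show ?thesis by (simp add: prod.distrib multi_abs_def power_sum)
  qed
  moreover have "(\<Prod>j\<in>UNIV. fact (\<alpha> j) :: real) \<ge> 0" by (intro prod_nonneg) simp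
  ultimately show ?thesis by (simp add: norm_divide)
qed

text \<open>The expansion of the Hermite polynomial of \<open>x \<bullet> w\<close>, integrated
  against \<open>f\<close> and the Gaussian. The scale \<open>r\<close> covers every real vector
  \<open>y = r *\<^sub>R w\<close>, so the right side is a homogeneous polynomial of degree
  \<open>n\<close> in \<open>y\<close>.\<close>

lemma hermite_coeff_expansion:
  fixes f :: "real^'n \<Rightarrow> complex" and w :: "real^'n"
  assumes f: "integrable lborel f" and w: "norm w = 1"
  shows "of_real (r ^ n) * hermite_coeff f w n = (\<Sum>X\<in>multisets_of_size UNIV n.
      of_real (\<Prod>j\<in>UNIV. ((r *\<^sub>R w) $ j) ^ count X j) *
      (hermite_moment f (count X) / of_real (\<Prod>j\<in>UNIV. fact (count X j))))"
proof -
  let ?g = "\<lambda>X x. f x * of_real (exp (- (norm x)\<^sup>2 / 2) * (\<Prod>j\<in>UNIV. poly (hermite_poly (count X j)) (x $ j)))"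
  let ?c = "\<lambda>X. of_real (\<Prod>j\<in>UNIV. (r * w $ j) ^ count X j / fact (count X j)) :: complex"
  have "of_real (r ^ n) * hermite_coeff f w n =
     (LINT x|lborel. f x * of_real (exp (- (norm x)\<^sup>2 / 2) * (r ^ n * (poly (hermite_poly n) (x \<bullet> w) / fact n))))"
    unfolding hermite_coeff_def integral_mult_right_zero[symmetric] by (simp add: mult_ac)
  also have "\<dots> = (LINT x|lborel. (\<Sum>X\<in>multisets_of_size UNIV n. ?c X * ?g X x))"
    unfolding hermite_poly_inner_expansion[OF w] of_real_mult of_real_sum sum_distrib_left
    by (simp only: mult_ac)
  also have "\<dots> = (\<Sum>X\<in>multisets_of_size UNIV n. LINT x|lborel. ?c X * ?g X x)"
    by (intro Bochner_Integration.integral_sum integrable_mult_right integrable_hermite_moment f)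
  also have "\<dots> = (\<Sum>X\<in>multisets_of_size UNIV n. ?c X * hermite_moment f (count X))"
    by (simp only: hermite_moment_def integral_mult_right_zero)
  finally show ?thesis by (simp add: prod_dividef)
qed

text \<open>\<open>homogeneous_coeff_bound\<close> is applied with \<open>c = 2 / d^2\<close>, where
  \<open>d\<close> is the dimension: then \<open>(2 / c) ^ n = d ^ (2 * n)\<close>, whose square
  root is the factor \<open>d ^ n\<close>. The condition \<open>c < 1\<close> is where
  \<open>d >= 2\<close> enters.\<close>

lemma hermite_moment_bound:
  fixes f :: "real^'n \<Rightarrow> complex"
  assumes f: "integrable lborel f" and d: "CARD('n) \<ge> 2" and M: "M > 0"
    and le: "\<And>w. norm w = 1 \<Longrightarrow> norm (hermite_coeff f w (multi_abs \<alpha>)) \<le> M"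
  shows "norm (hermite_moment f \<alpha>) \<le> M * sqrt (fact (multi_abs \<alpha>) * ((real CARD('n))\<^sup>2) ^ multi_abs \<alpha>
      * (\<Prod>j\<in>UNIV. fact (\<alpha> j)) * (1 / sqrt (1 - 2 / (real CARD('n))\<^sup>2)) ^ CARD('n))"
proof -
  define n where "n = multi_abs \<alpha>"
  define A where "A X = hermite_moment f (count X) / of_real (\<Prod>j\<in>UNIV. fact (count X j))" for X
  define X where "X = Abs_multiset \<alpha>"
  have X: "count X = \<alpha>" by (simp add: X_def)
  have "size X = (\<Sum>j\<in>UNIV. count X j)"
    unfolding size_multiset_overloaded_eq by (rule sum.mono_neutral_left) (auto simp: not_in_iff)
  then have sX: "size X = n" by (simp add: X n_def multi_abs_def)
  have P: "norm (\<Sum>X\<in>multisets_of_size UNIV n. of_real (\<Prod>j\<in>UNIV. (y $ j) ^ count X j) * A X) \<le> M * norm y ^ n" for y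
  proof -
    \<comment> \<open>Polar form of \<open>y\<close>; at \<open>y = 0\<close> any unit vector
      serves.\<close>
    obtain w where w: "norm w = 1" "y = norm y *\<^sub>R w"
    proof (cases "y = 0")
      case True
      then show ?thesis using that[of "axis undefined 1"] by simp
    next
      case False
      then show ?thesis using that[of "y /\<^sub>R norm y"] by simp
    qed
    have "(\<Sum>X\<in>multisets_of_size UNIV n. of_real (\<Prod>j\<in>UNIV. (y $ j) ^ count X j) * A X)
        = of_real (norm y ^ n) * hermite_coeff f w n"
      unfolding hermite_coeff_expansion[OF f w(1)] A_def w(2)[symmetric] ..
    also have "norm \<dots> = norm y ^ n * norm (hermite_coeff f w n)"
      by (simp add: norm_mult norm_power)
    also have "\<dots> \<le> norm y ^ n * M"
      using le[OF w(1)] by (intro mult_left_mono) (auto simp: n_def)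
    finally show ?thesis by (simp add: mult.commute)
  qed
  have d2: "(real CARD('n))\<^sup>2 > 2"
  proof -
    have "2\<^sup>2 \<le> (real CARD('n))\<^sup>2" using d by (intro power_mono) auto
    then show ?thesis by simp
  qed
  have F: "(\<Prod>j\<in>UNIV. fact (\<alpha> j) :: real) > 0" by (intro prod_pos) simp
  have "norm (A X) * (\<Prod>j\<in>UNIV. fact (\<alpha> j))
     \<le> M * sqrt (fact n * (2 / (2 / (real CARD('n))\<^sup>2)) ^ n * (\<Prod>j\<in>UNIV. fact (\<alpha> j)) * (1 / sqrt (1 - 2 / (real CARD('n))\<^sup>2)) ^ CARD('n))"
    using d2 X sX by (intro homogeneous_coeff_bound P M) auto
  moreover have "norm (A X) * (\<Prod>j\<in>UNIV. fact (\<alpha> j)) = norm (hermite_moment f \<alpha>)"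
    using F by (simp add: A_def X norm_divide abs_of_pos flip: of_real_prod)
  ultimately show ?thesis by (simp add: n_def)
qed

theorem theorem3p4:
  fixes f :: "real^'n \<Rightarrow> complex" and \<gamma> :: real
  assumes "\<gamma> > 0"
    and "f \<in> hardy_class (tanh (2 * \<gamma>))"
  shows "\<exists>C>0. \<forall>\<alpha> :: 'n \<Rightarrow> nat. multi_abs \<alpha> \<ge> 1 \<longrightarrow>
           norm (l2_inner f (\<lambda>x. complex_of_real (hermite_multi \<alpha> x)))
             \<le> C * real CARD('n) ^ multi_abs \<alpha>
                 * real (multi_abs \<alpha>) powr ((real CARD('n) - 2) / 4)
                 * exp (- \<gamma> * real (multi_abs \<alpha>))"
proof -
  have int: "integrable lborel f" using assms(2) by (simp add: hardy_class_def)
  obtain C where C: "C > 0" and le: "\<And>w n. norm w = 1 \<Longrightarrow> n \<ge> 1 \<Longrightarrow>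
     norm (hermite_coeff f w n) * sqrt (fact n) \<le> C * sqrt 2 ^ n * exp (- \<gamma> * real n) * real n powr (-1/4)"
    using hermite_coeff_bound_fact[OF assms] by blast
  define d where "d = real CARD('n)"
  define p where "p = sqrt pi ^ CARD('n)"
  have p: "p > 0" by (simp add: p_def)
  define F where "F \<alpha> = (\<Prod>j\<in>UNIV. fact (\<alpha> j) :: real)" for \<alpha> :: "'n \<Rightarrow> nat"
  have F: "F \<alpha> > 0" for \<alpha> unfolding F_def by (intro prod_pos) simp
  have d1: "d \<ge> 1" unfolding d_def by simp
  \<comment> \<open>Both cases reach the power \<open>-1/4\<close> of the degree, which equals
    \<open>(d - 2) / 4\<close> in dimension one and lies below it in higher dimensions.\<close>
  have "\<exists>D>0. \<forall>\<alpha> :: 'n \<Rightarrow> nat. multi_abs \<alpha> \<ge> 1 \<longrightarrow>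
      norm (hermite_moment f \<alpha>) / sqrt (2 ^ multi_abs \<alpha> * F \<alpha> * p)
      \<le> D * d ^ multi_abs \<alpha> * real (multi_abs \<alpha>) powr (-1/4) * exp (- \<gamma> * real (multi_abs \<alpha>))"
  proof (cases "CARD('n) = 1")
    case True
    then obtain i :: 'n where i: "UNIV = {i}" by (auto simp: card_1_singleton_iff)
    show ?thesis
    proof (intro exI[of _ "C / sqrt p"] conjI allI impI)
      show "C / sqrt p > 0" using C p by simp
      fix \<alpha> :: "'n \<Rightarrow> nat" assume n: "multi_abs \<alpha> \<ge> 1"
      define n where "n = multi_abs \<alpha>"
      have \<alpha>: "\<alpha> i = n" "F \<alpha> = fact n" by (simp_all add: n_def multi_abs_def F_def i)
      define w :: "real^'n" where "w = axis i 1"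
      have w: "norm w = 1" by (simp add: w_def)
      \<comment> \<open>With one coordinate the product has a single factor, so the moment is
        already a slice coefficient up to \<open>fact n\<close>. The choice
        \<open>c = 2 / d^2\<close> of the other case would exceed 1 here.\<close>
      have "hermite_moment f \<alpha> = of_real (fact n) * hermite_coeff f w n"
        unfolding hermite_coeff_def hermite_moment_def i integral_mult_right_zero[symmetric]
        by (simp add: \<alpha> w_def inner_axis)
      then have "norm (hermite_moment f \<alpha>) / sqrt (2 ^ n * F \<alpha> * p)
          = (fact n / sqrt (fact n)) * norm (hermite_coeff f w n) / (sqrt 2 ^ n * sqrt p)"
        by (simp add: norm_mult \<alpha> real_sqrt_mult real_sqrt_power)
      also have "fact n / sqrt (fact n) = sqrt (fact n)" by (simp add: real_div_sqrt)
      also have "sqrt (fact n) * norm (hermite_coeff f w n) / (sqrt 2 ^ n * sqrt p)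
          \<le> (C * sqrt 2 ^ n * exp (- \<gamma> * real n) * real n powr (-1/4)) / (sqrt 2 ^ n * sqrt p)"
        using le[OF w, of n] n p by (intro divide_right_mono) (auto simp: n_def mult.commute)
      also have "\<dots> = C / sqrt p * d ^ n * real n powr (-1/4) * exp (- \<gamma> * real n)"
        using p by (simp add: d_def True)
      finally show "norm (hermite_moment f \<alpha>) / sqrt (2 ^ multi_abs \<alpha> * F \<alpha> * p)
        \<le> C / sqrt p * d ^ multi_abs \<alpha> * real (multi_abs \<alpha>) powr (-1/4) * exp (- \<gamma> * real (multi_abs \<alpha>))"
        by (simp only: n_def)
    qed
  next
    case False
    moreover have "CARD('n) > 0" by simp
    ultimately have d2: "CARD('n) \<ge> 2" by linarith
    define k where "k = (1 / sqrt (1 - 2 / d\<^sup>2)) ^ CARD('n)"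
    have "2\<^sup>2 \<le> d\<^sup>2" using d2 unfolding d_def by (intro power_mono) auto
    then have "2 / d\<^sup>2 < 1" by (simp add: divide_less_eq)
    then have k: "k > 0" by (simp add: k_def)
    show ?thesis
    proof (intro exI[of _ "C * sqrt (k / p)"] conjI allI impI)
      show "C * sqrt (k / p) > 0" using C p k by simp
      fix \<alpha> :: "'n \<Rightarrow> nat" assume n1: "multi_abs \<alpha> \<ge> 1"
      define n where "n = multi_abs \<alpha>"
      define B where "B = C * sqrt 2 ^ n * exp (- \<gamma> * real n) * real n powr (-1/4)"
      have B: "B > 0" using C n1 by (simp add: B_def n_def)
      \<comment> \<open>The slice bound is \<open>B / sqrt (fact n)\<close>, so its factorial
        cancels the one produced by isolating the coefficient.\<close>
      have "norm (hermite_moment f \<alpha>) \<le> B / sqrt (fact n) * sqrt (fact n * (d\<^sup>2) ^ n * F \<alpha> * k)"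
        unfolding n_def d_def F_def k_def
      proof (rule hermite_moment_bound[OF int d2])
        show "B / sqrt (fact (multi_abs \<alpha>)) > 0" using B by simp
        show "norm (hermite_coeff f w (multi_abs \<alpha>)) \<le> B / sqrt (fact (multi_abs \<alpha>))" if "norm w = 1" for w
          using le[OF that n1] by (simp add: B_def n_def field_simps)
      qed
      also have "\<dots> = B * d ^ n * sqrt (F \<alpha>) * sqrt k"
        using d1 by (simp add: real_sqrt_mult real_sqrt_power)
      finally have "norm (hermite_moment f \<alpha>) / sqrt (2 ^ n * F \<alpha> * p) \<le> B * d ^ n * sqrt (F \<alpha>) * sqrt k / sqrt (2 ^ n * F \<alpha> * p)"
        using F[of \<alpha>] p by (intro divide_right_mono) auto
      also have "\<dots> = C * sqrt (k / p) * d ^ n * real n powr (-1/4) * exp (- \<gamma> * real n)"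
        using F[of \<alpha>] p by (simp add: real_sqrt_mult real_sqrt_power real_sqrt_divide B_def)
      finally show "norm (hermite_moment f \<alpha>) / sqrt (2 ^ multi_abs \<alpha> * F \<alpha> * p)
        \<le> C * sqrt (k / p) * d ^ multi_abs \<alpha> * real (multi_abs \<alpha>) powr (-1/4) * exp (- \<gamma> * real (multi_abs \<alpha>))"
        by (simp only: n_def)
    qed
  qed
  then obtain D where D: "D > 0" and bound: "\<And>\<alpha> :: 'n \<Rightarrow> nat. multi_abs \<alpha> \<ge> 1 \<Longrightarrow>
      norm (hermite_moment f \<alpha>) / sqrt (2 ^ multi_abs \<alpha> * F \<alpha> * p)
      \<le> D * d ^ multi_abs \<alpha> * real (multi_abs \<alpha>) powr (-1/4) * exp (- \<gamma> * real (multi_abs \<alpha>))"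
    by blast
  show ?thesis
  proof (intro exI[of _ D] conjI allI impI)
    fix \<alpha> :: "'n \<Rightarrow> nat" assume n: "multi_abs \<alpha> \<ge> 1"
    have "norm (l2_inner f (\<lambda>x. complex_of_real (hermite_multi \<alpha> x)))
       \<le> D * d ^ multi_abs \<alpha> * real (multi_abs \<alpha>) powr (-1/4) * exp (- \<gamma> * real (multi_abs \<alpha>))"
      using bound[OF n] unfolding l2_inner_hermite_multi F_def p_def .
    \<comment> \<open>The base is at least 1, so raising the exponent from \<open>-1/4\<close> to
      \<open>(d - 2) / 4\<close> can only enlarge the bound.\<close>
    also have "\<dots> \<le> D * d ^ multi_abs \<alpha> * real (multi_abs \<alpha>) powr ((d - 2) / 4) * exp (- \<gamma> * real (multi_abs \<alpha>))"
      using D d1 n by (intro mult_right_mono mult_left_mono powr_mono) auto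
    finally show "norm (l2_inner f (\<lambda>x. complex_of_real (hermite_multi \<alpha> x)))
             \<le> D * real CARD('n) ^ multi_abs \<alpha>
                 * real (multi_abs \<alpha>) powr ((real CARD('n) - 2) / 4)
                 * exp (- \<gamma> * real (multi_abs \<alpha>))"
      by (simp only: d_def)
  qed (rule D)
qed

end
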